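(* There is a constant $c>0$ such that for infinitely many positive integers $g$, there exists a graph embeddable on a surface of Euler genus $g$ that has no $\left(0,0,\lfloor c\sqrt{g}\rfloor,\lfloor c\sqrt{g}\rfloor\right)$-coloring.
   Context: All graphs are finite and simple (no loops, no multiple edges). For integers $d_1,\ldots,d_k$, a $(d_1,\ldots,d_k)$-coloring of a graph $G$ is an assignment to each vertex of a color from $\{1,\ldots,k\}$ such that for each $i$, every vertex colored $i$ has at most $d_i$ neighbors colored $i$. A surface is a non-null compact connected 2-manifold without boundary. The Euler genus of a surface is $2h$ if it is the orientable surface obtained from the sphere by adding $h\ge 0$ handles, and $k$ if it is the non-orientable surface obtained from the sphere by adding $k\ge 1$ cross-caps. *)

theory Defs
  imports "HOL-Analysis.Analysis"
begin

definition simple_graph :: "'v set \<Rightarrow> 'v set set \<Rightarrow> bool" where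
  "simple_graph V E \<longleftrightarrow> finite V \<and> (\<forall>e\<in>E. e \<subseteq> V \<and> card e = 2)"

(* The entry d_i of the list ds is ds ! (i - 1), since the colors are 1, ..., k. *)
definition improper_coloring ::
    "int list \<Rightarrow> 'v set \<Rightarrow> 'v set set \<Rightarrow> ('v \<Rightarrow> nat) \<Rightarrow> bool" where
  "improper_coloring ds V E f \<longleftrightarrow>
     (\<forall>v\<in>V. f v \<in> {1..length ds} \<and>
        int (card {u \<in> V. {u, v} \<in> E \<and> f u = f v}) \<le> ds ! (f v - 1))"

(* Second countability is automatic for a compact locally Euclidean space. *)
definition surface :: "'a topology \<Rightarrow> bool" where
  "surface X \<longleftrightarrow>
     topspace X \<noteq> {} \<and> compact_space X \<and> connected_space X \<and> Hausdorff_space X \<and>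
     (\<forall>x\<in>topspace X. \<exists>U (W :: (real^2) set).
        openin X U \<and> x \<in> U \<and> open W \<and>
        subtopology X U homeomorphic_space top_of_set W)"

definition cap :: "real^3 \<Rightarrow> real \<Rightarrow> (real^3) set" where
  "cap c t = {x \<in> sphere 0 1. c \<bullet> x \<ge> t}"

definition open_cap :: "real^3 \<Rightarrow> real \<Rightarrow> (real^3) set" where
  "open_cap c t = {x \<in> sphere 0 1. c \<bullet> x > t}"

definition rim :: "real^3 \<Rightarrow> real \<Rightarrow> (real^3) set" where
  "rim c t = {x \<in> sphere 0 1. c \<bullet> x = t}"

(* The i-th handle is attached by removing the interiors of two disjoint congruent caps, centred
   at a i and R i *v a i, and gluing their rims along the isometry R i. Since R i reverses the
   orientation of the sphere and maps one cap onto the other, the gluing reverses the boundary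
   orientations of the punctured sphere, so the result is orientable (gluing along a rotation
   would give a Klein bottle handle). The quotient space is only determined up to homeomorphism. *)
definition sphere_with_handles :: "nat \<Rightarrow> 'a topology \<Rightarrow> bool" where
  "sphere_with_handles h X \<longleftrightarrow>
     (\<exists>(a :: nat \<Rightarrow> real^3) (t :: nat \<Rightarrow> real) (R :: nat \<Rightarrow> real^3^3) (q :: real^3 \<Rightarrow> 'a).
        (\<forall>i<h. norm (a i) = 1 \<and> -1 < t i \<and> t i < 1 \<and> rotoinversion_matrix (R i)) \<and>
        (\<forall>i<h. \<forall>j<h. disjnt (cap (a i) (t i)) (cap (R j *v a j) (t j))) \<and>
        (\<forall>i<h. \<forall>j<h. i \<noteq> j \<longrightarrow>
           disjnt (cap (a i) (t i)) (cap (a j) (t j)) \<and>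
           disjnt (cap (R i *v a i) (t i)) (cap (R j *v a j) (t j))) \<and>
        (let P = sphere 0 1 - (\<Union>i<h. open_cap (a i) (t i) \<union> open_cap (R i *v a i) (t i)) in
           quotient_map (top_of_set P) X q \<and>
           (\<forall>x\<in>P. \<forall>y\<in>P. q x = q y \<longleftrightarrow>
              x = y \<or>
              (\<exists>i<h. (x \<in> rim (a i) (t i) \<and> y = R i *v x) \<or>
                     (y \<in> rim (a i) (t i) \<and> x = R i *v y)))))"

(* A cross-cap is attached by removing the interior of a cap and identifying antipodal points of
   its rim. The point antipodal to x on the circle rim (a i) (t i), whose centre is
   t i *\<^sub>R a i, is 2 * t i *\<^sub>R a i - x. *)
definition sphere_with_crosscaps :: "nat \<Rightarrow> 'a topology \<Rightarrow> bool" where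
  "sphere_with_crosscaps k X \<longleftrightarrow>
     (\<exists>(a :: nat \<Rightarrow> real^3) (t :: nat \<Rightarrow> real) (q :: real^3 \<Rightarrow> 'a).
        (\<forall>i<k. norm (a i) = 1 \<and> -1 < t i \<and> t i < 1) \<and>
        (\<forall>i<k. \<forall>j<k. i \<noteq> j \<longrightarrow> disjnt (cap (a i) (t i)) (cap (a j) (t j))) \<and>
        (let P = sphere 0 1 - (\<Union>i<k. open_cap (a i) (t i)) in
           quotient_map (top_of_set P) X q \<and>
           (\<forall>x\<in>P. \<forall>y\<in>P. q x = q y \<longleftrightarrow>
              x = y \<or> (\<exists>i<k. x \<in> rim (a i) (t i) \<and> y = (2 * t i) *\<^sub>R a i - x))))"

definition has_euler_genus :: "'a topology \<Rightarrow> nat \<Rightarrow> bool" where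
  "has_euler_genus X g \<longleftrightarrow>
     (\<exists>h. g = 2 * h \<and> sphere_with_handles h X) \<or>
     (\<exists>k\<ge>1. g = k \<and> sphere_with_crosscaps k X)"

definition graph_embeddable :: "'v set \<Rightarrow> 'v set set \<Rightarrow> 'a topology \<Rightarrow> bool" where
  "graph_embeddable V E X \<longleftrightarrow>
     (\<exists>(p :: 'v \<Rightarrow> 'a) (\<gamma> :: 'v set \<Rightarrow> real \<Rightarrow> 'a).
        inj_on p V \<and> p ` V \<subseteq> topspace X \<and>
        (\<forall>e\<in>E. pathin X (\<gamma> e) \<and> inj_on (\<gamma> e) {0..1} \<and>
               {\<gamma> e 0, \<gamma> e 1} = p ` e \<and> disjnt (\<gamma> e ` {0<..<1}) (p ` V)) \<and>
        (\<forall>e\<in>E. \<forall>e'\<in>E. e \<noteq> e' \<longrightarrow> disjnt (\<gamma> e ` {0<..<1}) (\<gamma> e' ` {0<..<1})))"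

end

(* Two of the colour classes of a (0,0,d,d)-coloring of K_n have at most one vertex and the other
   two at most d + 1, so n <= 2d + 4. On the other hand K_n embeds in the sphere with one handle
   per edge, of Euler genus n(n - 1) < n^2: cut every edge into two half-edges, draw the n stars of
   half-edges disjointly on the sphere, centre a small cap at the tip of each half-edge, and glue
   the rims of the two caps of an edge so that its halves join up. *)
theory Submission
  imports Defs
begin

text \<open>The orientable genus of K_n is only about n^2/12, but \<open>c\<close> is free, so any
  embedding with O(n^2) handles serves, and one handle per edge treats all edges alike. Since a
  sphere with handles is a concrete quotient, most of the work is to show that this quotient is a
  compact connected surface, with charts across the glued rims. The gluing isometry of a handle must
  do two things at once: reverse orientation, and carry the tip of one half-edge to the tip of its
  partner. There is just enough freedom: a rotation takes centre to centre and rim point to rim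
  point, and the reflection in the plane spanned by the two images fixes both. Caps disjoint from
  each other and from foreign half-edges exist because finitely many conditions, each true for all
  small caps, hold together. A half-edge is then cut where it first meets the rim of its own
  cap.\<close>

section \<open>Complete graphs and improper colorings\<close>

text \<open>In a complete graph the neighbors of \<open>v\<close> with its color are all the other
  vertices of its class, so the defect bounds the class size minus one.\<close>

lemma complete_graph_color_class:
  assumes "improper_coloring ds V {e. e \<subseteq> V \<and> card e = 2} f" and "finite V" and "v \<in> V"
  shows "int (card {u \<in> V. f u = f v}) \<le> ds ! (f v - 1) + 1"
proof -
  have "{u \<in> V. {u, v} \<in> {e. e \<subseteq> V \<and> card e = 2} \<and> f u = f v} = {u \<in> V. f u = f v} - {v}"
    using \<open>v \<in> V\<close> by (auto simp: card_2_iff)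
  moreover have "card ({u \<in> V. f u = f v} - {v}) = card {u \<in> V. f u = f v} - 1"
    using assms by (simp add: card_Diff_singleton)
  moreover have "card {u \<in> V. f u = f v} > 0"
    using assms by (auto simp: card_gt_0_iff)
  ultimately show ?thesis
    using assms unfolding improper_coloring_def by fastforce
qed

text \<open>The classes cover \<open>V\<close>, so their size bounds add up. Nonnegativity of the
  defects serves the colors that no vertex takes: an empty class must still satisfy
  \<open>0 \<le> ds ! i + 1\<close>.\<close>

lemma complete_graph_improper_coloring_bound:
  assumes col: "improper_coloring ds V {e. e \<subseteq> V \<and> card e = 2} f" and "finite V"
    and nonneg: "\<And>d. d \<in> set ds \<Longrightarrow> 0 \<le> d"
  shows "int (card V) \<le> (\<Sum>i<length ds. ds ! i + 1)"
proof -
  have class_le: "int (card {v \<in> V. f v = Suc i}) \<le> ds ! i + 1" if "i < length ds" for i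
  proof (cases "\<exists>v\<in>V. f v = Suc i")
    case True
    then show ?thesis using complete_graph_color_class[OF col \<open>finite V\<close>] by fastforce
  next
    case False
    then have "{v \<in> V. f v = Suc i} = {}" by auto
    then have "card {v \<in> V. f v = Suc i} = 0" by (simp only: card.empty)
    then show ?thesis using nonneg[of "ds ! i"] that by simp
  qed
  have "V \<subseteq> (\<Union>i<length ds. {v \<in> V. f v = Suc i})"
  proof -
    have "\<exists>i<length ds. f v = Suc i" if "v \<in> V" for v
      using col that unfolding improper_coloring_def
      by (metis Suc_le_eq Suc_pred atLeastAtMost_iff less_eq_Suc_le One_nat_def)
    then show ?thesis by auto
  qed
  then have "card V \<le> card (\<Union>i<length ds. {v \<in> V. f v = Suc i})"
    using \<open>finite V\<close> by (intro card_mono) auto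
  also have "\<dots> \<le> (\<Sum>i<length ds. card {v \<in> V. f v = Suc i})"
    by (rule card_UN_le) simp
  finally have "int (card V) \<le> (\<Sum>i<length ds. int (card {v \<in> V. f v = Suc i}))"
    by (metis of_nat_mono of_nat_sum)
  also have "\<dots> \<le> (\<Sum>i<length ds. ds ! i + 1)"
    using class_le by (intro sum_mono) auto
  finally show ?thesis .
qed

section \<open>Isometries and coordinates\<close>

lemma rotation_matrix_of_orthonormal:
  fixes a u :: "real^3"
  assumes "norm a = 1" "norm u = 1" "a \<bullet> u = 0"
  shows "\<exists>M. rotation_matrix M \<and> M *v a = axis 1 1 \<and> M *v u = axis 2 1"
proof -
  define M :: "real^3^3" where "M = vector [a, u, cross3 a u]"
  have aa: "a \<bullet> a = 1" "u \<bullet> u = 1" "u \<bullet> a = 0"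
    using assms by (simp_all add: norm_eq_1 inner_commute)
  have cc: "(cross3 a u) \<bullet> (cross3 a u) = 1"
    using norm_cross_dot[of a u] assms by (simp add: power2_norm_eq_inner)
  then have nc: "norm (cross3 a u) = 1" by (simp add: norm_eq_1)
  have oc: "a \<bullet> (cross3 a u) = 0" "u \<bullet> (cross3 a u) = 0" "(cross3 a u) \<bullet> a = 0" "(cross3 a u) \<bullet> u = 0"
    by (simp_all add: dot_cross_self)
  have rows: "row 1 M = a" "row 2 M = u" "row 3 M = cross3 a u"
    by (simp_all add: M_def row_def vec_eq_iff)
  have mv: "M *v x = vector [a \<bullet> x, u \<bullet> x, (cross3 a u) \<bullet> x]" for x
    by (simp add: vec_eq_iff forall_3 M_def matrix_vector_mul_component)
  have "orthogonal_matrix M"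
    unfolding orthogonal_matrix_orthonormal_rows forall_3 rows orthogonal_def
    using aa(3) oc nc assms by simp
  moreover have "det M = 1"
  proof -
    have "det M = a \<bullet> cross3 u (cross3 a u)" by (simp add: dot_cross_det M_def)
    also have "\<dots> = (cross3 a u) \<bullet> (cross3 a u)"
      by (simp add: cross3_simps)
    finally show ?thesis using cc by simp
  qed
  moreover have "M *v a = axis 1 1" "M *v u = axis 2 1"
    using aa oc assms by (simp_all add: mv vec_eq_iff forall_3 axis_def)
  ultimately show ?thesis by (auto simp: rotation_matrix_def)
qed

text \<open>Supplies the gluing map of a handle. Rotations bring both pairs, a cap centre and a
  marked rim point each, into the same position in the plane of the first two axes; the reflection
  in that plane is inserted between one rotation and the inverse of the other. The strict bounds on
  \<open>t\<close> keep the rim from shrinking to a point.\<close>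

lemma rotoinversion_matrix_exists:
  fixes a x b y :: "real^3"
  assumes "norm a = 1" "norm b = 1" "norm x = 1" "norm y = 1"
    and "a \<bullet> x = t" "b \<bullet> y = t" "-1 < t" "t < 1"
  shows "\<exists>R. rotoinversion_matrix R \<and> R *v a = b \<and> R *v x = y"
proof -
  \<comment> \<open>\<open>s\<close> is the radius of the rim at height \<open>t\<close>;
    \<open>u\<close> and \<open>v\<close> will be the unit directions from the centres of the two
    rims to the marked points.\<close>
  define s where "s = sqrt (1 - t\<^sup>2)"
  have "t\<^sup>2 < 1" using assms by (simp add: abs_square_less_1 abs_less_iff)
  then have s: "s > 0" "s\<^sup>2 = 1 - t\<^sup>2" by (simp_all add: s_def)
  define u where "u = (x - t *\<^sub>R a) /\<^sub>R s"
  define v where "v = (y - t *\<^sub>R b) /\<^sub>R s"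
  have *: "norm ((p - t *\<^sub>R c) /\<^sub>R s) = 1 \<and> c \<bullet> ((p - t *\<^sub>R c) /\<^sub>R s) = 0"
    if "norm c = 1" "norm p = 1" "c \<bullet> p = t" for c p :: "real^3"
  proof -
    have cc: "c \<bullet> c = 1" "p \<bullet> p = 1" "p \<bullet> c = t"
      using that by (simp_all add: norm_eq_1 inner_commute)
    then have "(p - t *\<^sub>R c) \<bullet> (p - t *\<^sub>R c) = s\<^sup>2"
      using that s by (simp add: inner_diff_left inner_diff_right power2_eq_square)
    then have "norm (p - t *\<^sub>R c) = s"
      using s by (metis norm_eq_sqrt_inner real_sqrt_unique less_imp_le)
    then show ?thesis using s cc that by (simp add: inner_diff_right)
  qed
  have "norm u = 1" "a \<bullet> u = 0" "norm v = 1" "b \<bullet> v = 0"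
    using * assms by (auto simp: u_def v_def)
  then obtain M N where M: "rotation_matrix M" "M *v a = axis 1 1" "M *v u = axis 2 1"
    and N: "rotation_matrix N" "N *v b = axis 1 1" "N *v v = axis 2 1"
    using rotation_matrix_of_orthonormal assms by metis
  define D :: "real^3^3" where "D = (\<chi> i j. if i = j then (if i = 3 then -1 else 1) else 0)"
  have D: "rotoinversion_matrix D" "D *v axis 1 1 = axis 1 1" "D *v axis 2 1 = axis 2 1"
    by (simp_all add: rotoinversion_matrix_def orthogonal_matrix D_def vec_eq_iff forall_3
        matrix_matrix_mult_def sum_3 transpose_def mat_def det_3 matrix_vector_mult_def axis_def)
  define R where "R = transpose N ** (D ** M)"
  have R: "rotoinversion_matrix R"
    using M N D by (auto simp: R_def rotation_matrix_def rotoinversion_matrix_def det_mul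
        orthogonal_matrix_mul orthogonal_matrix_transpose)
  have Nt: "transpose N *v (N *v z) = z" for z
    using N by (simp add: rotation_matrix_def orthogonal_matrix matrix_vector_mul_assoc)
  have Ra: "R *v a = b" and Ru: "R *v u = v"
    using M N D Nt by (metis R_def matrix_vector_mul_assoc)+
  have "x = t *\<^sub>R a + s *\<^sub>R u" "y = t *\<^sub>R b + s *\<^sub>R v"
    using s by (simp_all add: u_def v_def)
  then have "R *v x = y"
    by (simp add: matrix_vector_right_distrib matrix_vector_mult_scaleR Ra Ru)
  with R Ra show ?thesis by blast
qed

text \<open>An orthogonal map turning the third axis into \<open>a\<close> makes the first two
  coordinates an isometric copy of the plane orthogonal to \<open>a\<close>. The charts need this
  copy because \<open>surface\<close> asks for open subsets of \<open>real^2\<close>, whereas the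
  sphere lies in \<open>real^3\<close>.\<close>

lemma plane_coordinates:
  fixes a :: "real^3"
  assumes "norm a = 1"
  obtains L :: "real^3 \<Rightarrow> real^2" and L' :: "real^2 \<Rightarrow> real^3"
  where "linear L" "linear L'" "\<And>p. L (L' p) = p" "\<And>p. norm (L' p) = norm p" "L a = 0"
    "\<And>p. a \<bullet> L' p = 0" "\<And>x. (a \<bullet> x) *\<^sub>R a + L' (L x) = x"
proof -
  obtain f :: "real^3 \<Rightarrow> real^3" where f: "orthogonal_transformation f" "f (axis 3 1) = a"
    using orthogonal_transformation_exists_1[of "axis 3 1 :: real^3" a] assms by auto
  define g where "g = inv f"
  have g: "orthogonal_transformation g"
    using f by (simp add: g_def orthogonal_transformation_inv)
  have lf: "linear f" and lg: "linear g"
    using f g by (simp_all add: orthogonal_transformation_linear)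
  have fg: "f (g x) = x" "g (f x) = x" for x
    using f by (simp_all add: g_def orthogonal_transformation_surj surj_f_inv_f
        orthogonal_transformation_inj inv_f_f)
  have ga: "g a = axis 3 1" using f fg by metis
  define L :: "real^3 \<Rightarrow> real^2" where "L = (\<lambda>x. vector [g x $ 1, g x $ 2])"
  define L' :: "real^2 \<Rightarrow> real^3" where "L' = (\<lambda>p. f (vector [p $ 1, p $ 2, 0]))"
  have inner_f: "f x \<bullet> f y = x \<bullet> y" and inner_g: "g x \<bullet> g y = x \<bullet> y" for x y
    using f g by (auto simp: orthogonal_transformation_def)
  show ?thesis
  proof
    show "linear L"
      by (rule linearI) (simp_all add: L_def vec_eq_iff forall_2 linear_add[OF lg] linear_cmul[OF lg])
    have vec3: "vector [p $ 1 + r $ 1, p $ 2 + r $ 2, 0] = vector [p $ 1, p $ 2, 0] + (vector [r $ 1, r $ 2, 0] :: real^3)"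
      "vector [c * p $ 1, c * p $ 2, 0] = c *\<^sub>R (vector [p $ 1, p $ 2, 0] :: real^3)" for p r :: "real^2" and c
      by (simp_all add: vec_eq_iff forall_3)
    show "linear L'"
      by (rule linearI) (simp_all add: L'_def vec3 linear_add[OF lf] linear_cmul[OF lf])
    show "L (L' p) = p" for p
      by (simp add: L_def L'_def fg vec_eq_iff forall_2)
    show "norm (L' p) = norm p" for p
      by (simp add: L'_def norm_eq inner_f) (simp add: inner_vec_def sum_2 sum_3)
    show "L a = 0" by (simp add: L_def ga vec_eq_iff forall_2 axis_def)
    show "a \<bullet> L' p = 0" for p
      by (metis L'_def f(2) inner_f inner_axis' vector_3(3) mult_zero_right inner_real_def)
    show "(a \<bullet> x) *\<^sub>R a + L' (L x) = x" for x
    proof -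
      have "a \<bullet> x = g x $ 3"
        by (metis ga inner_g inner_axis' inner_real_def mult_1)
      then have "g ((a \<bullet> x) *\<^sub>R a + L' (L x)) = g x"
        by (simp add: linear_add[OF lg] linear_cmul[OF lg] ga L'_def L_def fg vec_eq_iff forall_3 axis_def)
      then show ?thesis using fg by metis
    qed
  qed
qed

section \<open>Spheres with disjoint caps removed\<close>

definition punctured_sphere :: "'k set \<Rightarrow> ('k \<Rightarrow> real^3) \<Rightarrow> ('k \<Rightarrow> real) \<Rightarrow> (real^3) set" where
  "punctured_sphere I c t = sphere 0 1 - (\<Union>k\<in>I. open_cap (c k) (t k))"

text \<open>Only open caps are removed, so the rims remain and the set is cut from the sphere by
  closed half-spaces.\<close>

lemma compact_punctured_sphere: "compact (punctured_sphere I c t)"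
proof -
  have "punctured_sphere I c t = sphere 0 1 \<inter> (\<Inter>k\<in>I. {x. c k \<bullet> x \<le> t k})"
    by (force simp: punctured_sphere_def open_cap_def not_less)
  moreover have "closed (\<Inter>k\<in>I. {x. c k \<bullet> x \<le> t k})"
    by (intro closed_INT ballI closed_halfspace_le)
  ultimately show ?thesis by (simp add: compact_Int_closed)
qed

lemma closed_cap: "closed (cap c t)"
proof -
  have "cap c t = sphere 0 1 \<inter> {x. c \<bullet> x \<ge> t}" by (auto simp: cap_def)
  then show ?thesis by (simp add: closed_Int closed_halfspace_ge)
qed

lemma compact_rim: "compact (rim c t)"
proof -
  have "rim c t = sphere 0 1 \<inter> {x. c \<bullet> x = t}" by (auto simp: rim_def)
  then show ?thesis by (simp add: compact_Int_closed closed_hyperplane)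
qed

lemma rim_subset_cap: "rim c t \<subseteq> cap c t"
  by (auto simp: rim_def cap_def)

(* The point of the unit sphere at height s above the plane orthogonal to a, in the direction p. *)
definition spherical_point :: "real^3 \<Rightarrow> (real^2 \<Rightarrow> real^3) \<Rightarrow> real \<Rightarrow> real^2 \<Rightarrow> real^3" where
  "spherical_point a L' s p = s *\<^sub>R a + (sqrt (1 - s\<^sup>2) / norm p) *\<^sub>R L' p"

section \<open>Cylindrical coordinates on the sphere\<close>

locale plane_coords =
  fixes a :: "real^3" and L :: "real^3 \<Rightarrow> real^2" and L' :: "real^2 \<Rightarrow> real^3"
  assumes norm_a: "norm a = 1" and lin: "linear L" "linear L'"
    and LL' [simp]: "L (L' p) = p" and norm_L' [simp]: "norm (L' p) = norm p" and La [simp]: "L a = 0"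
    and aL' [simp]: "a \<bullet> L' p = 0" and decomp: "(a \<bullet> x) *\<^sub>R a + L' (L x) = x"
begin

lemma aa [simp]: "a \<bullet> a = 1"
  using norm_a by (simp add: norm_eq_1)

lemma norm_decomp: "(norm (s *\<^sub>R a + L' p))\<^sup>2 = s\<^sup>2 + (norm p)\<^sup>2"
proof -
  have "L' p \<bullet> L' p = (norm p)\<^sup>2" by (simp flip: power2_norm_eq_inner)
  then show ?thesis
    by (simp add: power2_norm_eq_inner inner_add_left inner_add_right inner_commute[of "L' p" a])
      (simp add: power2_eq_square)
qed

lemma norm_L: "(norm (L x))\<^sup>2 = (norm x)\<^sup>2 - (a \<bullet> x)\<^sup>2"
  using norm_decomp[of "a \<bullet> x" "L x"] decomp[of x] by simp

lemma cont_L: "continuous_on S L" and cont_L': "continuous_on T L'"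
  using lin by (auto intro: linear_continuous_on linear_conv_bounded_linear[THEN iffD1])

abbreviation "B \<equiv> spherical_point a L'"

text \<open>The angular coordinate: away from the poles of the unit sphere \<open>dir x\<close> is a
  unit vector of the plane. \<open>B\<close> recovers the point from its height and direction. The
  length of a nonzero \<open>p\<close> does not affect \<open>B s p\<close>, so in the annular
  charts one vector \<open>p\<close> can carry the angle and, through its norm, the height.\<close>

definition "dir x = L x /\<^sub>R sqrt (1 - (a \<bullet> x)\<^sup>2)"

lemma inner_B [simp]: "a \<bullet> B s p = s"
  by (simp add: spherical_point_def inner_add_right)

lemma norm_B: assumes "-1 < s" "s < 1" "p \<noteq> 0" shows "norm (B s p) = 1"
proof -
  have "s\<^sup>2 < 1" using assms by (simp add: abs_square_less_1 abs_less_iff)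
  have "(norm (B s p))\<^sup>2 = s\<^sup>2 + (norm ((sqrt (1 - s\<^sup>2) / norm p) *\<^sub>R p))\<^sup>2"
    unfolding spherical_point_def using norm_decomp[of s "(sqrt (1 - s\<^sup>2) / norm p) *\<^sub>R p"] lin
    by (simp add: linear_cmul)
  also have "\<dots> = 1"
    using assms \<open>s\<^sup>2 < 1\<close> by (simp add: power_mult_distrib power_divide)
  finally have "(norm (B s p))\<^sup>2 = 1" .
  then show ?thesis by (simp add: power2_eq_1_iff) (metis norm_ge_zero neg_0_le_iff_le not_one_le_zero)
qed

lemma dir_B: assumes "-1 < s" "s < 1" shows "dir (B s p) = p /\<^sub>R norm p"
proof -
  have "s\<^sup>2 < 1" using assms by (simp add: abs_square_less_1 abs_less_iff)
  then show ?thesis unfolding dir_def inner_B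
    using lin by (simp add: spherical_point_def linear_add linear_cmul divide_simps)
qed

lemma norm_dir: assumes "norm x = 1" "-1 < a \<bullet> x" "a \<bullet> x < 1" shows "norm (dir x) = 1"
proof -
  have "(a \<bullet> x)\<^sup>2 < 1" using assms by (simp add: abs_square_less_1 abs_less_iff)
  moreover have "norm (L x) = sqrt (1 - (a \<bullet> x)\<^sup>2)"
    using norm_L[of x] assms by (metis norm_ge_zero one_power2 real_sqrt_unique)
  ultimately show ?thesis by (simp add: dir_def)
qed

lemma B_dir: assumes "norm x = 1" "-1 < a \<bullet> x" "a \<bullet> x < 1" "0 < r"
  shows "B (a \<bullet> x) (r *\<^sub>R dir x) = x"
proof -
  have "(a \<bullet> x)\<^sup>2 < 1" using assms by (simp add: abs_square_less_1 abs_less_iff)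
  then have "(sqrt (1 - (a \<bullet> x)\<^sup>2) / norm (r *\<^sub>R dir x)) *\<^sub>R L' (r *\<^sub>R dir x) = L' (L x)"
    using assms lin by (simp add: norm_dir linear_cmul) (simp add: dir_def linear_cmul)
  then show ?thesis by (simp add: spherical_point_def decomp)
qed

lemma cont_B:
  assumes "continuous_on S s" "0 \<notin> S"
  shows "continuous_on S (\<lambda>p. B (s p) p)"
  unfolding spherical_point_def using assms
  by (intro continuous_intros cont_L') auto

lemma cont_dir:
  assumes "\<And>x. x \<in> S \<Longrightarrow> -1 < a \<bullet> x \<and> a \<bullet> x < 1"
  shows "continuous_on S dir"
proof -
  have "sqrt (1 - (a \<bullet> x)\<^sup>2) \<noteq> 0" if "x \<in> S" for x
  proof -
    have "(a \<bullet> x)\<^sup>2 < 1" using assms[OF that] by (simp add: abs_square_less_1 abs_less_iff)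
    then show ?thesis by simp
  qed
  then show ?thesis unfolding dir_def by (intro continuous_intros cont_L) auto
qed

lemma connected_rim:
  assumes "-1 < s" "s < 1"
  shows "connected (rim a s)"
proof -
  have "rim a s = B s ` sphere 0 1"
  proof safe
    fix x assume "x \<in> rim a s"
    then have x: "norm x = 1" "a \<bullet> x = s" by (auto simp: rim_def)
    then have "x = B s (dir x)" using B_dir[of x 1] assms by simp
    moreover have "norm (dir x) = 1" using norm_dir x assms by simp
    ultimately show "x \<in> B s ` sphere 0 1" by auto
  next
    fix p :: "real^2" assume "p \<in> sphere 0 1"
    then show "B s p \<in> rim a s" using norm_B[of s p] assms by (cases "p = 0") (auto simp: rim_def)
  qed
  moreover have "connected (sphere (0 :: real^2) 1)" by (rule connected_sphere) simp
  moreover have "continuous_on (sphere 0 1) (B s)"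
    using cont_B[of "sphere 0 1" "\<lambda>_. s"] by simp
  ultimately show ?thesis by (simp add: connected_continuous_image)
qed

end

lemma plane_coords_exist:
  assumes "norm a = 1"
  obtains L L' where "plane_coords a L L'"
  using plane_coordinates[OF assms] assms unfolding plane_coords_def by metis

text \<open>The smaller of the excesses \<open>a \<bullet> x - s\<close> and
  \<open>b \<bullet> x - r\<close> is negative on the whole sphere and attains its maximum there, so
  both heights can be lowered by some \<open>\<delta>\<close> with the open caps still disjoint.
  This leaves room for collars around the rims.\<close>

lemma disjoint_caps_margin:
  fixes a b :: "real^3"
  assumes "disjnt (cap a s) (cap b r)"
  shows "\<exists>\<delta>>0. \<forall>x\<in>sphere 0 1. a \<bullet> x \<le> s - \<delta> \<or> b \<bullet> x \<le> r - \<delta>"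
proof -
  define m where "m x = min (a \<bullet> x - s) (b \<bullet> x - r)" for x
  have "sphere (0::real^3) 1 \<noteq> {}" by simp
  moreover have "continuous_on (sphere 0 1) m" unfolding m_def by (intro continuous_intros)
  ultimately obtain x0 where x0: "x0 \<in> sphere 0 1" "\<And>x. x \<in> sphere 0 1 \<Longrightarrow> m x \<le> m x0"
    using continuous_attains_sup[of "sphere 0 1" m] compact_sphere by blast
  have "m x0 < 0"
    using assms x0(1) by (force simp: disjnt_def cap_def m_def)
  then show ?thesis
    using x0(2) by (intro exI[of _ "- m x0"]) (force simp: m_def min_le_iff_disj)
qed

section \<open>Connectedness of the punctured sphere\<close>

lemma rim_nonempty:
  assumes "norm a = 1" "-1 < s" "s < 1"
  shows "rim a s \<noteq> {}"
proof -
  obtain L L' where pc: "plane_coords a L L'" using plane_coords_exist[OF assms(1)] by blast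
  have "spherical_point a L' s (axis 1 1) \<in> rim a s"
    using plane_coords.norm_B[OF pc] plane_coords.inner_B[OF pc] assms
    by (auto simp: rim_def axis_eq_0_iff)
  then show ?thesis by blast
qed

lemma rim_subset_punctured_sphere:
  assumes "k \<in> I" "\<And>l. l \<in> I \<Longrightarrow> k \<noteq> l \<Longrightarrow> disjnt (cap (c k) (t k)) (cap (c l) (t l))"
  shows "rim (c k) (t k) \<subseteq> punctured_sphere I c t"
proof
  fix x assume x: "x \<in> rim (c k) (t k)"
  have "x \<notin> open_cap (c l) (t l)" if "l \<in> I" for l
  proof (cases "l = k")
    case True
    then show ?thesis using x by (auto simp: rim_def open_cap_def)
  next
    case False
    then show ?thesis using assms(2)[OF that] x
      by (auto simp: disjnt_iff cap_def rim_def open_cap_def)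
  qed
  then show "x \<in> punctured_sphere I c t" using x by (auto simp: punctured_sphere_def rim_def)
qed

lemma connected_punctured_sphere:
  assumes "finite I" and unit: "\<And>k. k \<in> I \<Longrightarrow> norm (c k) = 1"
    and range: "\<And>k. k \<in> I \<Longrightarrow> -1 < t k \<and> t k < 1"
    and disj: "\<And>k l. k \<in> I \<Longrightarrow> l \<in> I \<Longrightarrow> k \<noteq> l \<Longrightarrow> disjnt (cap (c k) (t k)) (cap (c l) (t l))"
  shows "connected (punctured_sphere I c t)"
proof -
  let ?P = "punctured_sphere I c t"
  have rimP: "rim (c k) (t k) \<subseteq> ?P" if "k \<in> I" for k
    using that disj by (intro rim_subset_punctured_sphere)
  have capP: "cap (c k) (t k) \<inter> ?P \<subseteq> rim (c k) (t k)" if "k \<in> I" for k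
    using that by (force simp: cap_def rim_def punctured_sphere_def open_cap_def)
  have conn: "connected (rim (c k) (t k))" if k: "k \<in> I" for k
  proof -
    obtain L L' where "plane_coords (c k) L L'" using plane_coords_exist unit[OF k] by blast
    then show ?thesis using range[OF k] by (simp add: plane_coords.connected_rim)
  qed
  have S: "sphere 0 1 = ?P \<union> (\<Union>k\<in>I. cap (c k) (t k))"
    by (auto simp: punctured_sphere_def open_cap_def cap_def)
  show ?thesis
    unfolding connected_closed_set[OF compact_imp_closed[OF compact_punctured_sphere]]
  proof
    assume "\<exists>A B. closed A \<and> closed B \<and> A \<noteq> {} \<and> B \<noteq> {} \<and> A \<union> B = ?P \<and> A \<inter> B = {}"
    then obtain A B where AB: "closed A" "closed B" "A \<noteq> {}" "B \<noteq> {}" "A \<union> B = ?P" "A \<inter> B = {}"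
      by blast
    \<comment> \<open>Each rim lies on one side of the separation, so filling in the caps separates the sphere.\<close>
    define fill where "fill C = C \<union> (\<Union>k\<in>{k \<in> I. rim (c k) (t k) \<subseteq> C}. cap (c k) (t k))" for C
    have side: "rim (c k) (t k) \<subseteq> A \<or> rim (c k) (t k) \<subseteq> B" if "k \<in> I" for k
      using connected_closedD[OF conn[OF that], of A B] AB rimP[OF that] by blast
    have rim_ne: "rim (c k) (t k) \<noteq> {}" if "k \<in> I" for k
      using rim_nonempty unit[OF that] range[OF that] by blast
    have closed_fill: "closed (fill C)" if "closed C" for C
      unfolding fill_def using that \<open>finite I\<close> by (intro closed_Un closed_UN closed_cap ballI) auto
    have "fill A \<union> fill B = sphere 0 1"
      unfolding S fill_def using AB(5) side by blast
    moreover have "fill A \<inter> fill B = {}"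
    proof -
      have "A \<subseteq> ?P" "B \<subseteq> ?P" using AB by auto
      have False if x: "x \<in> fill A" "x \<in> fill B" for x
      proof -
        consider "x \<in> A" "x \<in> B"
          | k where "x \<in> A" "k \<in> I" "rim (c k) (t k) \<subseteq> B" "x \<in> cap (c k) (t k)"
          | k where "x \<in> B" "k \<in> I" "rim (c k) (t k) \<subseteq> A" "x \<in> cap (c k) (t k)"
          | k l where "k \<in> I" "l \<in> I" "rim (c k) (t k) \<subseteq> A" "rim (c l) (t l) \<subseteq> B"
            "x \<in> cap (c k) (t k)" "x \<in> cap (c l) (t l)"
          using x unfolding fill_def by blast
        then show False
        proof cases
          \<comment> \<open>The caps are distinct because rims are nonempty: a common rim would lie
            in both \<open>A\<close> and \<open>B\<close>.\<close>
          case 4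
          then show False using disj[of k l] AB(6) rim_ne[of k] by (fastforce simp: disjnt_iff)
        qed (use AB(6) capP \<open>A \<subseteq> ?P\<close> \<open>B \<subseteq> ?P\<close> in blast)+
      qed
      then show ?thesis by blast
    qed
    moreover have "fill A \<noteq> {}" "fill B \<noteq> {}" using AB by (auto simp: fill_def)
    moreover have "connected (sphere (0::real^3) 1)" by (rule connected_sphere) simp
    ultimately show False
      using closed_fill[OF AB(1)] closed_fill[OF AB(2)]
      unfolding connected_closed_set[OF closed_sphere] by blast
  qed
qed

section \<open>Gluing paired rims\<close>

(* The rims of the caps k and flip k are glued along M k, so each handle is indexed twice. *)
locale cap_pairing =
  fixes I :: "'k set" and c :: "'k \<Rightarrow> real^3" and t :: "'k \<Rightarrow> real" and flip :: "'k \<Rightarrow> 'k"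
    and M :: "'k \<Rightarrow> real^3 \<Rightarrow> real^3"
  assumes fin: "finite I"
    and unit: "k \<in> I \<Longrightarrow> norm (c k) = 1"
    and range: "k \<in> I \<Longrightarrow> -1 < t k \<and> t k < 1"
    and disj: "k \<in> I \<Longrightarrow> l \<in> I \<Longrightarrow> k \<noteq> l \<Longrightarrow> disjnt (cap (c k) (t k)) (cap (c l) (t l))"
    and flip: "k \<in> I \<Longrightarrow> flip k \<in> I" "k \<in> I \<Longrightarrow> flip k \<noteq> k" "flip (flip k) = k"
      "t (flip k) = t k"
    and orth: "k \<in> I \<Longrightarrow> orthogonal_transformation (M k)"
    and M_c: "k \<in> I \<Longrightarrow> M k (c k) = c (flip k)"
    and M_M: "k \<in> I \<Longrightarrow> M (flip k) (M k x) = x"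
begin

abbreviation "P \<equiv> punctured_sphere I c t"

lemma norm_M [simp]: "k \<in> I \<Longrightarrow> norm (M k x) = norm x"
  using orth orthogonal_transformation_norm by blast

lemma inner_M: "k \<in> I \<Longrightarrow> c (flip k) \<bullet> M k x = c k \<bullet> x"
  using orth[of k] M_c[of k] by (metis orthogonal_transformation_def)

lemma cont_M: "k \<in> I \<Longrightarrow> continuous_on S (M k)"
  using orth orthogonal_transformation_linear linear_continuous_on linear_conv_bounded_linear by blast

lemma M_rim: "k \<in> I \<Longrightarrow> x \<in> rim (c k) (t k) \<Longrightarrow> M k x \<in> rim (c (flip k)) (t (flip k))"
  by (simp add: rim_def inner_M flip)

lemma M_M': "k \<in> I \<Longrightarrow> M k (M (flip k) x) = x"
  using M_M[of "flip k" x] flip by simp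

lemma rim_subset_P: "k \<in> I \<Longrightarrow> rim (c k) (t k) \<subseteq> P"
  by (rule rim_subset_punctured_sphere) (auto intro: disj)

lemma rim_unique:
  assumes "k \<in> I" "l \<in> I" "x \<in> rim (c k) (t k)" "x \<in> rim (c l) (t l)"
  shows "k = l"
  using disj[of k l] assms rim_subset_cap by (fastforce simp: disjnt_iff)

end

text \<open>\<open>q_eq\<close> states the gluing in one direction; the other one is the instance
  for \<open>flip k\<close>, whose map inverts \<open>M k\<close>. The target type of
  \<open>q\<close> stays open because the quotient matters only up to homeomorphism.\<close>

locale cap_gluing = cap_pairing I c t flip M
  for I :: "'k set" and c :: "'k \<Rightarrow> real^3" and t :: "'k \<Rightarrow> real" and flip :: "'k \<Rightarrow> 'k"
    and M :: "'k \<Rightarrow> real^3 \<Rightarrow> real^3" +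
  fixes q :: "real^3 \<Rightarrow> 'a" and X :: "'a topology"
  assumes quot: "quotient_map (top_of_set (punctured_sphere I c t)) X q"
    and q_eq: "x \<in> punctured_sphere I c t \<Longrightarrow> y \<in> punctured_sphere I c t \<Longrightarrow>
      q x = q y \<longleftrightarrow> x = y \<or> (\<exists>k\<in>I. x \<in> rim (c k) (t k) \<and> y = M k x)"
begin

lemma q_M: "k \<in> I \<Longrightarrow> x \<in> rim (c k) (t k) \<Longrightarrow> q (M k x) = q x"
  using q_eq[of x "M k x"] rim_subset_P[of k] rim_subset_P[of "flip k"] M_rim flip(1)
  by (metis subsetD)

lemma openin_saturated:
  assumes "openin (top_of_set P) V" "{y \<in> P. q y \<in> q ` V} \<subseteq> V"
  shows "openin X (q ` V)"
  using quot assms unfolding quotient_map_saturated_open by simp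

section \<open>Separation, compactness and connectedness of the quotient\<close>

lemma topspace_X: "topspace X = q ` P"
  using quotient_imp_surjective_map[OF quot] by simp

lemma cont_q: "continuous_map (top_of_set P) X q"
  using quot quotient_imp_continuous_map by blast

text \<open>Saturating a closed \<open>C\<close> only adds isometric images of its intersections
  with finitely many rims. These are compact, so the saturation is closed again.\<close>

lemma closed_map_q: "closed_map (top_of_set P) X q"
  unfolding closed_map_def
proof (intro allI impI)
  fix C assume "closedin (top_of_set P) C"
  then have "C \<subseteq> P" and C: "compact C"
    using closedin_imp_subset closedin_compact[OF compact_punctured_sphere] by blast+
  have "{x \<in> P. q x \<in> q ` C} = C \<union> (\<Union>k\<in>I. M k ` (C \<inter> rim (c k) (t k)))"
  proof safe
    fix x y assume xy: "x \<in> P" "y \<in> C" "q x = q y"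
      and x: "x \<notin> (\<Union>k\<in>I. M k ` (C \<inter> rim (c k) (t k)))"
    then have "y = x \<or> (\<exists>k\<in>I. y \<in> rim (c k) (t k) \<and> x = M k y)"
      using q_eq[of y x] \<open>C \<subseteq> P\<close> by auto
    then show "x \<in> C" using xy(2) x by blast
  next
    fix x k assume x: "k \<in> I" "x \<in> C" "x \<in> rim (c k) (t k)"
    then show "q (M k x) \<in> q ` C" using q_M by simp
    show "M k x \<in> P" using x M_rim rim_subset_P flip by blast
  qed (use \<open>C \<subseteq> P\<close> in auto)
  moreover have "compact (\<Union>k\<in>I. M k ` (C \<inter> rim (c k) (t k)))"
    using fin C by (intro compact_UN compact_continuous_image cont_M compact_Int compact_rim) auto
  ultimately have "closed {x \<in> P. q x \<in> q ` C}"
    using C by (simp only: compact_Un compact_imp_closed)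
  then have "closedin (top_of_set P) {x \<in> P. q x \<in> q ` C}"
    by (rule closed_subset[rotated]) auto
  moreover have "q ` C \<subseteq> topspace X" using \<open>C \<subseteq> P\<close> topspace_X by blast
  ultimately show "closedin X (q ` C)"
    using quot unfolding quotient_map_closedin by simp
qed

text \<open>A quotient of a Hausdorff space need not be Hausdorff, but normality and T1 pass to the
  image of a continuous closed map.\<close>

lemma Hausdorff_X: "Hausdorff_space X"
proof -
  have "normal_space (top_of_set P)"
    using compact_punctured_sphere[of I c t]
    by (intro compact_Hausdorff_or_regular_imp_normal_space)
      (auto simp: Hausdorff_space_subtopology compact_space_subtopology compactin_euclidean_iff)
  then have "normal_space X"
    using normal_space_continuous_closed_map_image cont_q closed_map_q topspace_X by fastforce
  moreover have "t1_space X"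
    using t1_space_closed_map_image[OF closed_map_q] topspace_X
    by (simp add: Hausdorff_imp_t1_space Hausdorff_space_subtopology)
  ultimately show ?thesis by (rule normal_t1_imp_Hausdorff_space)
qed

lemma compact_X: "compact_space X"
proof -
  have "compact_space (top_of_set P)"
    using compact_punctured_sphere by (intro compact_space_subtopology) auto
  then show ?thesis
    using image_compactin[OF _ cont_q, of P] topspace_X by (simp add: compact_space_def)
qed

lemma connected_X: "connected_space X"
proof -
  have "connected P" using connected_punctured_sphere[of I c t] fin unit range disj by blast
  then show ?thesis
    using connected_space_quotient_map_image[OF quot]
    by (simp add: connected_space_subtopology)
qed

section \<open>Charts of the quotient\<close>

lemma homeomorphic_interior:
  assumes "x \<in> P" and off: "\<And>k. k \<in> I \<Longrightarrow> x \<notin> rim (c k) (t k)"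
  shows "\<exists>U (W :: (real^2) set). openin X U \<and> q x \<in> U \<and> open W \<and>
    subtopology X U homeomorphic_space top_of_set W"
proof -
  have "norm x = 1" using \<open>x \<in> P\<close> by (auto simp: punctured_sphere_def)
  then obtain L L' where pc: "plane_coords x L L'" using plane_coords_exist by blast
  interpret plane_coords x L L' by (fact pc)
  \<comment> \<open>The part of the open hemisphere around \<open>x\<close> strictly outside all
    caps. It meets no rim, so the fibers of \<open>q\<close> through it are single points.\<close>
  define V where "V = {y \<in> sphere 0 1. (\<forall>k\<in>I. c k \<bullet> y < t k) \<and> x \<bullet> y > 0}"
  \<comment> \<open>The inverse of the orthogonal projection of the hemisphere onto the unit disc in
    the plane orthogonal to \<open>x\<close>.\<close>
  define B' where "B' p = sqrt (1 - (norm p)\<^sup>2) *\<^sub>R x + L' p" for p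
  define W where "W = ball 0 1 \<inter> (\<Inter>k\<in>I. {p. c k \<bullet> B' p < t k})"
  have VP: "V \<subseteq> P" by (force simp: V_def punctured_sphere_def open_cap_def)
  have contB: "continuous_on UNIV B'"
    unfolding B'_def by (intro continuous_intros cont_L')
  have "open W" unfolding W_def using fin
    by (intro open_Int open_INT ballI open_Collect_less continuous_intros contB) auto
  have xV: "x \<in> V"
  proof -
    have "c k \<bullet> x < t k" if "k \<in> I" for k
      using off[OF that] assms(1) that
      by (force simp: punctured_sphere_def open_cap_def rim_def)
    then show ?thesis using \<open>norm x = 1\<close> by (simp add: V_def)
  qed
  have injV: "y = z" if "y \<in> P" "z \<in> V" "q y = q z" for y z
  proof -
    have "z \<notin> rim (c k) (t k)" if "k \<in> I" for k using that \<open>z \<in> V\<close> by (auto simp: V_def rim_def)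
    then show ?thesis using q_eq[of z y] that VP by auto
  qed
  then have sat: "{y \<in> P. q y \<in> q ` V} = V" using VP by blast
  have opV: "openin (top_of_set P) V"
  proof -
    have "V = P \<inter> ((\<Inter>k\<in>I. {y. c k \<bullet> y < t k}) \<inter> {y. x \<bullet> y > 0})"
      using VP by (auto simp: V_def punctured_sphere_def)
    moreover have "open ((\<Inter>k\<in>I. {y. c k \<bullet> y < t k}) \<inter> {y. x \<bullet> y > 0})"
      using fin by (intro open_Int open_INT ballI open_halfspace_lt open_halfspace_gt)
    ultimately show ?thesis unfolding openin_open by blast
  qed
  have opU: "openin X (q ` V)"
    by (rule openin_saturated[OF opV]) (simp add: sat)
  have "quotient_map (subtopology (top_of_set P) V) (subtopology X (q ` V)) q"
    by (rule quotient_map_restriction[OF quot]) (use sat opU in auto)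
  moreover have "inj_on q V" using injV VP by (meson inj_onI subsetD)
  moreover have "subtopology (top_of_set P) V = top_of_set V"
    using VP by (simp add: subtopology_subtopology Int_absorb1)
  ultimately have "homeomorphic_map (top_of_set V) (subtopology X (q ` V)) q"
    by (simp add: homeomorphic_map_def)
  then have "subtopology X (q ` V) homeomorphic_space top_of_set V"
    using homeomorphic_map_imp_homeomorphic_space homeomorphic_space_sym by blast
  moreover have "top_of_set V homeomorphic_space top_of_set W"
  proof -
    have nB: "norm (B' p) = 1" if "norm p < 1" for p
    proof -
      have "(norm p)\<^sup>2 < 1" using that by (simp add: abs_square_less_1)
      then have "(norm (B' p))\<^sup>2 = 1" unfolding B'_def by (simp add: norm_decomp)
      then show ?thesis by (metis norm_ge_zero one_power2 power2_eq_imp_eq zero_le_one)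
    qed
    have xB: "x \<bullet> B' p > 0" if "norm p < 1" for p
      using that by (simp add: B'_def inner_add_right abs_square_less_1)
    have LB: "L (B' p) = p" for p
      using lin by (simp add: B'_def linear_add linear_cmul)
    have BL: "B' (L y) = y" and nL: "norm (L y) < 1" if "y \<in> V" for y
    proof -
      have y: "norm y = 1" "x \<bullet> y > 0" using that by (auto simp: V_def)
      then have *: "(norm (L y))\<^sup>2 = 1 - (x \<bullet> y)\<^sup>2" using norm_L[of y] by simp
      then show "B' (L y) = y" using y decomp[of y] by (simp add: B'_def)
      have "(norm (L y))\<^sup>2 < 1\<^sup>2" using * y by simp
      then show "norm (L y) < 1" by (rule power2_less_imp_less) simp
    qed
    have "homeomorphic_maps (top_of_set V) (top_of_set W) L B'"
      unfolding homeomorphic_maps_def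
    proof (intro conjI)
      show "continuous_map (top_of_set V) (top_of_set W) L"
        using nL BL by (auto simp: cont_L W_def V_def)
      show "continuous_map (top_of_set W) (top_of_set V) B'"
        using nB xB continuous_on_subset[OF contB] by (auto simp: W_def V_def)
    qed (use BL LB in auto)
    then show ?thesis unfolding homeomorphic_space_def by blast
  qed
  ultimately have "subtopology X (q ` V) homeomorphic_space top_of_set W"
    using homeomorphic_space_trans by blast
  then show ?thesis using opU xV \<open>open W\<close> by blast
qed

text \<open>Each of the finitely many requirements holds for all small \<open>\<delta>\<close>. By
  the last one a point is close to at most one cap, so collars of height \<open>\<delta>\<close> are
  disjoint; \<open>-1 < t k - \<delta>\<close> keeps them off the pole where \<open>dir\<close>
  degenerates, and \<open>\<delta> < 1\<close> keeps the annulus of radii between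
  \<open>1 - \<delta>\<close> and \<open>1 + \<delta>\<close> off the origin.\<close>

lemma margin:
  obtains \<delta> where "\<delta> > 0" "\<delta> < 1" "\<And>k. k \<in> I \<Longrightarrow> -1 < t k - \<delta>"
    "\<And>k l x. k \<in> I \<Longrightarrow> l \<in> I \<Longrightarrow> k \<noteq> l \<Longrightarrow> norm x = 1 \<Longrightarrow> c k \<bullet> x \<le> t k - \<delta> \<or> c l \<bullet> x \<le> t l - \<delta>"
proof -
  have "\<forall>\<^sub>F \<delta> in at_right 0. \<delta> < 1 \<and> (\<forall>k\<in>I. -1 < t k - \<delta>) \<and> (\<forall>k\<in>I. \<forall>l\<in>I. k \<noteq> l \<longrightarrow>
    (\<forall>x. norm x = 1 \<longrightarrow> c k \<bullet> x \<le> t k - \<delta> \<or> c l \<bullet> x \<le> t l - \<delta>))"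
  proof (intro eventually_conj eventually_ball_finite fin ballI)
    show "\<forall>\<^sub>F \<delta>::real in at_right 0. \<delta> < 1"
      by (auto simp: eventually_at_right_field intro!: exI[of _ 1])
    fix k assume k: "k \<in> I"
    show "\<forall>\<^sub>F \<delta> in at_right 0. - 1 < t k - \<delta>"
      using range[OF k] by (auto simp: eventually_at_right_field intro!: exI[of _ "t k + 1"])
    fix l assume l: "l \<in> I"
    show "\<forall>\<^sub>F \<delta> in at_right 0. k \<noteq> l \<longrightarrow>
      (\<forall>x. norm x = 1 \<longrightarrow> c k \<bullet> x \<le> t k - \<delta> \<or> c l \<bullet> x \<le> t l - \<delta>)"
    proof (cases "k = l")
      case False
      then obtain d where "d > 0" "\<forall>x\<in>sphere 0 1. c k \<bullet> x \<le> t k - d \<or> c l \<bullet> x \<le> t l - d"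
        using disjoint_caps_margin[OF disj[OF k l]] by blast
      moreover have "\<forall>\<^sub>F \<delta> in at_right 0. \<delta> < d"
        using \<open>d > 0\<close> by (auto simp: eventually_at_right_field)
      ultimately show ?thesis
        by (auto elim!: eventually_mono) (smt (verit) mem_sphere_0)
    qed simp
  qed
  then have ev: "\<forall>\<^sub>F \<delta> in at_right (0::real). \<delta> > 0 \<and> \<delta> < 1 \<and> (\<forall>k\<in>I. -1 < t k - \<delta>) \<and> (\<forall>k\<in>I. \<forall>l\<in>I. k \<noteq> l \<longrightarrow>
    (\<forall>x. norm x = 1 \<longrightarrow> c k \<bullet> x \<le> t k - \<delta> \<or> c l \<bullet> x \<le> t l - \<delta>))"
    using eventually_at_right_less[of "0::real"] by eventually_elim blast
  obtain \<delta> :: real where "\<delta> > 0 \<and> \<delta> < 1 \<and> (\<forall>k\<in>I. -1 < t k - \<delta>) \<and> (\<forall>k\<in>I. \<forall>l\<in>I. k \<noteq> l \<longrightarrow>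
    (\<forall>x. norm x = 1 \<longrightarrow> c k \<bullet> x \<le> t k - \<delta> \<or> c l \<bullet> x \<le> t l - \<delta>))"
    using eventually_happens'[OF trivial_limit_at_right_real ev] ..
  then show ?thesis by (intro that[of \<delta>]) blast+
qed

text \<open>Instead of a small disc around the point, the chart takes in the whole glued rim with
  the collars \<open>A1\<close> and \<open>A2\<close> of its two copies. Their union is saturated
  and its image is an open annulus, which is an admissible chart domain because
  \<open>surface\<close> asks only for an open set of the plane.\<close>

lemma homeomorphic_rim:
  assumes k: "k \<in> I" and x0: "x0 \<in> rim (c k) (t k)"
  shows "\<exists>U (W :: (real^2) set). openin X U \<and> q x0 \<in> U \<and> open W \<and>
    subtopology X U homeomorphic_space top_of_set W"
proof -
  obtain L L' where pc: "plane_coords (c k) L L'" using plane_coords_exist unit[OF k] by blast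
  interpret plane_coords "c k" L L' by (fact pc)
  obtain \<delta> where \<delta>: "\<delta> > 0" "\<delta> < 1" and low: "\<And>l. l \<in> I \<Longrightarrow> -1 < t l - \<delta>"
    and sep: "\<And>l m x. l \<in> I \<Longrightarrow> m \<in> I \<Longrightarrow> l \<noteq> m \<Longrightarrow> norm x = 1 \<Longrightarrow>
      c l \<bullet> x \<le> t l - \<delta> \<or> c m \<bullet> x \<le> t m - \<delta>"
    by (rule margin) blast
  define k' where "k' = flip k"
  have k': "k' \<in> I" "k' \<noteq> k" "flip k' = k" "t k' = t k" "M k (c k) = c k'"
    using k flip M_c by (auto simp: k'_def)
  define s where "s = t k"
  have s: "-1 < s - \<delta>" "s < 1" "-1 < s" using low[OF k] range[OF k] by (auto simp: s_def)
  have inner_N: "c k \<bullet> M k' x = c k' \<bullet> x" for x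
    using inner_M[OF k'(1)] k' by simp
  have inner_Mk: "c k' \<bullet> M k x = c k \<bullet> x" for x
    using inner_M[OF k] by (simp add: k'_def)
  have MN: "M k (M k' x) = x" "M k' (M k x) = x" for x
    using M_M[OF k] M_M'[OF k] by (auto simp: k'_def)
  define A1 where "A1 = {x \<in> sphere 0 1. s - \<delta> < c k \<bullet> x \<and> c k \<bullet> x \<le> s}"
  define A2 where "A2 = {x \<in> sphere 0 1. s - \<delta> < c k' \<bullet> x \<and> c k' \<bullet> x \<le> s}"
  have notlow: "l = k \<or> c l \<bullet> x \<le> t l - \<delta>" if "x \<in> A1" "l \<in> I" for l x
    using sep[OF that(2) k, of x] that by (auto simp: A1_def s_def)
  have notlow': "l = k' \<or> c l \<bullet> x \<le> t l - \<delta>" if "x \<in> A2" "l \<in> I" for l x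
    using sep[OF that(2) k'(1), of x] that k' by (auto simp: A2_def s_def)
  have not1: "c k' \<bullet> x \<le> s - \<delta>" if "x \<in> A1" for x
    using notlow[OF that k'(1)] k' by (auto simp: s_def)
  have not2: "c k \<bullet> x \<le> s - \<delta>" if "x \<in> A2" for x
    using notlow'[OF that k] k' by (auto simp: s_def)
  have A1P: "A1 \<subseteq> P"
  proof
    fix x assume x: "x \<in> A1"
    then have "c l \<bullet> x \<le> t l" if "l \<in> I" for l
      using notlow[OF x that] \<delta> by (auto simp: A1_def s_def)
    then show "x \<in> P" using x by (force simp: A1_def punctured_sphere_def open_cap_def)
  qed
  have A2P: "A2 \<subseteq> P"
  proof
    fix x assume x: "x \<in> A2"
    then have "c l \<bullet> x \<le> t l" if "l \<in> I" for l
      using notlow'[OF x that] \<delta> k' by (auto simp: A2_def s_def)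
    then show "x \<in> P" using x by (force simp: A2_def punctured_sphere_def open_cap_def)
  qed
  define A where "A = A1 \<union> A2"
  have AP: "A \<subseteq> P" using A1P A2P by (simp add: A_def)
  have rim1: "rim (c k) (t k) \<subseteq> A1" and rim2: "rim (c k') (t k') \<subseteq> A2"
    using \<delta> k' by (auto simp: rim_def A1_def A2_def s_def)
  have rimA1: "l = k" if "x \<in> A1" "l \<in> I" "x \<in> rim (c l) (t l)" for l x
    using notlow[OF that(1,2)] that(3) \<delta> by (auto simp: rim_def)
  have rimA2: "l = k'" if "x \<in> A2" "l \<in> I" "x \<in> rim (c l) (t l)" for l x
    using notlow'[OF that(1,2)] that(3) \<delta> by (auto simp: rim_def)
  \<comment> \<open>Of all rims only those of \<open>k\<close> and \<open>k'\<close> meet the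
    collars, and gluing along the rim of \<open>k'\<close> is gluing along that of \<open>k\<close>
    read backwards.\<close>
  have fiber: "x = y \<or> x \<in> rim (c k) (t k) \<and> y = M k x \<or> y \<in> rim (c k) (t k) \<and> x = M k y"
    if xy: "x \<in> A" "y \<in> P" "q x = q y" for x y
  proof (cases "x = y")
    case False
    then obtain l where l: "l \<in> I" "x \<in> rim (c l) (t l)" "y = M l x"
      using q_eq[of x y] xy AP by auto
    then have "l = k \<or> l = k'" using rimA1 rimA2 xy(1) by (auto simp: A_def)
    then show ?thesis
    proof
      assume "l = k'"
      then show ?thesis using l M_rim[of k' x] k' MN by auto
    qed (use l in auto)
  qed simp
  have MkA: "M k x \<in> A" if "x \<in> rim (c k) (t k)" for x
    using M_rim[OF k that] rim2 by (auto simp: A_def k'_def)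
  have sat: "{x \<in> P. q x \<in> q ` A} = A"
  proof -
    have "y \<in> A" if y: "y \<in> P" "q y \<in> q ` A" for y
    proof -
      obtain x where x: "x \<in> A" "q x = q y" using y(2) by auto
      show ?thesis using fiber[OF x(1) y(1) x(2)] x(1) rim1 MkA by (auto simp: A_def)
    qed
    then show ?thesis using AP by auto
  qed
  \<comment> \<open>Inside \<open>P\<close> the upper bounds \<open>\<le> s\<close> hold
    automatically, so the open lower bounds alone describe \<open>A\<close>.\<close>
  have A_eq: "A = P \<inter> ({x. c k \<bullet> x > s - \<delta>} \<union> {x. c k' \<bullet> x > s - \<delta>})"
    using k k'(1,4) A1P A2P unfolding A_def
    by (force simp: A1_def A2_def punctured_sphere_def open_cap_def s_def)
  have opA: "openin (top_of_set P) A"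
    unfolding A_eq by (intro openin_open_Int open_Un open_halfspace_gt)
  have opU: "openin X (q ` A)"
    by (rule openin_saturated[OF opA]) (simp add: sat)
  have "quotient_map (subtopology (top_of_set P) A) (subtopology X (q ` A)) q"
    by (rule quotient_map_restriction[OF quot]) (use sat opU in auto)
  moreover have "subtopology (top_of_set P) A = top_of_set A"
    using AP by (simp add: subtopology_subtopology Int_absorb1)
  ultimately have qA: "quotient_map (top_of_set A) (subtopology X (q ` A)) q" by simp
  \<comment> \<open>The two bands adjacent to the glued rims form the outer and the inner half of an open annulus.\<close>
  define F where "F x = (if s - \<delta> < c k \<bullet> x then (1 + (s - c k \<bullet> x)) *\<^sub>R dir x
    else (1 - (s - c k' \<bullet> x)) *\<^sub>R dir (M k' x))" for x
  define W where "W = {p::real^2. 1 - \<delta> < norm p \<and> norm p < 1 + \<delta>}"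
  have "W = {p. 1 - \<delta> < norm p} \<inter> {p. norm p < 1 + \<delta>}" by (auto simp: W_def)
  then have "open W" by (simp add: open_Int open_Collect_less continuous_on_norm_id)
  have F1: "F x = (1 + (s - c k \<bullet> x)) *\<^sub>R dir x" "norm (dir x) = 1" if "x \<in> A1" for x
    using that norm_dir[of x] s by (auto simp: F_def A1_def)
  have F2: "F x = (1 - (s - c k' \<bullet> x)) *\<^sub>R dir (M k' x)" "norm (dir (M k' x)) = 1" if "x \<in> A2" for x
    using that norm_dir[of "M k' x"] s not2[OF that] k'(1) inner_N by (auto simp: F_def A2_def)
  have FW1: "norm (F x) = 1 + (s - c k \<bullet> x)" if "x \<in> A1" for x
    using F1[OF that] that by (simp add: A1_def)
  have FW2: "norm (F x) = 1 - (s - c k' \<bullet> x)" if "x \<in> A2" for x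
    using F2[OF that] that \<delta> by (simp add: A2_def)
  have FW: "F x \<in> W" if "x \<in> A" for x
    using that FW1[of x] FW2[of x] \<delta> by (auto simp: A_def W_def A1_def A2_def)
  have contF: "continuous_on A F"
    unfolding A_def F_def
  proof (rule continuous_on_cases_local)
    \<comment> \<open>Points of one collar have height at most \<open>s - \<delta>\<close> with
      respect to the other cap, so each collar is closed in the union and continuity can be checked
      on each separately.\<close>
    have "A1 = (A1 \<union> A2) \<inter> {x. c k' \<bullet> x \<le> s - \<delta>}" "A2 = (A1 \<union> A2) \<inter> {x. c k \<bullet> x \<le> s - \<delta>}"
      using not1 not2 by (auto simp: A1_def A2_def)
    then show "closedin (top_of_set (A1 \<union> A2)) A1" "closedin (top_of_set (A1 \<union> A2)) A2"
      by (metis closedin_closed_Int closed_halfspace_le)+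
    show "continuous_on A1 (\<lambda>x. (1 + (s - c k \<bullet> x)) *\<^sub>R dir x)"
      using s by (intro continuous_intros cont_dir) (auto simp: A1_def)
    have "continuous_on A2 (dir \<circ> M k')"
      using s k'(1) by (intro continuous_on_compose cont_dir cont_M) (auto simp: A2_def inner_N)
    then show "continuous_on A2 (\<lambda>x. (1 - (s - c k' \<bullet> x)) *\<^sub>R dir (M k' x))"
      by (intro continuous_intros) (simp add: o_def)
  qed (use not2 in \<open>force simp: A1_def\<close>)
  \<comment> \<open>On the rim both radii are 1, and turning \<open>M k x\<close> back by
    \<open>M k'\<close> gives the angle of \<open>x\<close>. Hence \<open>F\<close> is constant on
    fibers and descends to the quotient.\<close>
  have F_rim: "F (M k x) = F x" if "x \<in> rim (c k) (t k)" for x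
    using F1[of x] F2[of "M k x"] that rim1 rim2 M_rim[OF k that] MN inner_Mk
    by (auto simp: rim_def k'_def[symmetric] s_def subset_iff k'(4))
  have Fq: "F x = F y" if "x \<in> A" "y \<in> A" "q x = q y" for x y
    using fiber[of x y] that AP F_rim by (metis subsetD)
  have "continuous_map (top_of_set A) (top_of_set W) F"
    using contF FW by auto
  then obtain f where f: "continuous_map (subtopology X (q ` A)) (top_of_set W) f"
    and fq: "\<And>x. x \<in> A \<Longrightarrow> f (q x) = F x"
    using quotient_map_lift_exists[OF qA] Fq by (metis topspace_euclidean_subtopology)
  \<comment> \<open>The inverse of \<open>F\<close> in polar coordinates: the distance of
    \<open>norm p\<close> from 1 is the drop below the rim height \<open>s\<close>, on the collar of
    \<open>k\<close> outside the unit circle and on that of \<open>k'\<close> inside.\<close>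
  define G where "G p = (if 1 \<le> norm p then q (B (s + 1 - norm p) p)
    else q (M k (B (s - 1 + norm p) p)))" for p
  have G1: "B (s + 1 - norm p) p \<in> A1" if "p \<in> W" "1 \<le> norm p" for p
    using that s norm_B[of "s + 1 - norm p" p] by (cases "p = 0") (auto simp: A1_def W_def)
  have G2: "M k (B (s - 1 + norm p) p) \<in> A2" if "p \<in> W" "norm p \<le> 1" for p
  proof -
    have "p \<noteq> 0" using that \<delta> by (auto simp: W_def)
    then show ?thesis using that s norm_B[of "s - 1 + norm p" p] k
      by (auto simp: A2_def W_def inner_Mk)
  qed
  have zero: "0 \<notin> W" using \<delta> by (auto simp: W_def)
  have G: "continuous_map (top_of_set W) (subtopology X (q ` A)) G"
  proof (rule continuous_map_into_subtopology)
    show "continuous_map (top_of_set W) X G"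
      unfolding G_def
    proof (rule continuous_map_cases_le)
      have 1: "continuous_map (top_of_set {p \<in> W. 1 \<le> norm p}) (top_of_set P) (\<lambda>p. B (s + 1 - norm p) p)"
        using G1 A1P zero by (auto intro!: cont_B continuous_intros)
      show "continuous_map (subtopology (top_of_set W) {p \<in> topspace (top_of_set W). 1 \<le> norm p}) X
        (\<lambda>p. q (B (s + 1 - norm p) p))"
        using continuous_map_compose[OF 1 cont_q]
        by (simp add: subtopology_subtopology o_def Int_absorb1 Collect_subset)
      have "continuous_on {p \<in> W. norm p \<le> 1} (M k \<circ> (\<lambda>p. B (s - 1 + norm p) p))"
        using zero by (intro continuous_on_compose cont_M k cont_B continuous_intros) auto
      then have 2: "continuous_map (top_of_set {p \<in> W. norm p \<le> 1}) (top_of_set P) (\<lambda>p. M k (B (s - 1 + norm p) p))"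
        using G2 A2P by (auto simp: o_def)
      show "continuous_map (subtopology (top_of_set W) {p \<in> topspace (top_of_set W). norm p \<le> 1}) X
        (\<lambda>p. q (M k (B (s - 1 + norm p) p)))"
        using continuous_map_compose[OF 2 cont_q]
        by (simp add: subtopology_subtopology o_def Int_absorb1 Collect_subset)
      show "q (B (s + 1 - norm p) p) = q (M k (B (s - 1 + norm p) p))"
        if p: "p \<in> topspace (top_of_set W)" "1 = norm p" for p
      proof -
        have "B s p \<in> rim (c k) (t k)"
          using G1[of p] p by (simp add: rim_def A1_def flip: p(2)) (simp add: s_def)
        then show ?thesis using q_M[OF k] by (simp flip: p(2))
      qed
    qed (auto intro: continuous_on_norm_id)
    show "G \<in> topspace (top_of_set W) \<rightarrow> q ` A"
      using G1 G2 by (auto simp: G_def A_def)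
  qed
  have GF: "G (F x) = q x" if "x \<in> A" for x
  proof (cases "x \<in> A1")
    case True
    then show ?thesis
      using FW1[OF True] F1[OF True] B_dir[of x "1 + (s - c k \<bullet> x)"] s
      by (auto simp: G_def A1_def)
  next
    case False
    then have x: "x \<in> A2" using that by (simp add: A_def)
    define y where "y = M k' x"
    have y: "c k \<bullet> y = c k' \<bullet> x" "M k y = x" "norm y = 1"
      using x k'(1) by (auto simp: y_def inner_N MN A2_def)
    have nF: "norm (F x) = 1 - (s - c k \<bullet> y)" using FW2[OF x] y by simp
    have By: "B (c k \<bullet> y) (F x) = y"
      using F2[OF x] B_dir[of y "1 - (s - c k \<bullet> y)"] x y s \<delta> by (simp add: A2_def flip: y_def)
    show ?thesis
    proof (cases "c k \<bullet> y = s")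
      \<comment> \<open>At radius 1 \<open>G\<close> uses the outer formula and so yields the class
        of \<open>y\<close> itself; \<open>q\<close> identifies \<open>y\<close> with its partner
        \<open>M k y = x\<close>.\<close>
      case True
      then have "y \<in> rim (c k) (t k)" using y by (simp add: rim_def s_def)
      moreover have "G (F x) = q y" using nF By True by (simp add: G_def)
      ultimately show ?thesis using q_M[OF k] y by metis
    next
      case False
      then have "norm (F x) < 1" using nF x y by (simp add: A2_def)
      then show ?thesis using nF By y by (simp add: G_def)
    qed
  qed
  have FG: "f (G p) = p" if p: "p \<in> W" for p
  proof -
    have n: "norm p * inverse (norm p) = 1" using zero p by (intro right_inverse) auto
    show ?thesis
    proof (cases "1 \<le> norm p")
      case True
      have "dir (B (s + 1 - norm p) p) = p /\<^sub>R norm p"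
        using p s \<delta> True by (intro dir_B) (auto simp: W_def)
      then have "F (B (s + 1 - norm p) p) = p"
        using F1[OF G1[OF p True]] n by simp
      then show ?thesis using fq G1[OF p True] True by (simp add: G_def A_def)
    next
      case False
      then have le: "norm p \<le> 1" by simp
      have "dir (B (s - 1 + norm p) p) = p /\<^sub>R norm p"
        using p s \<delta> le by (intro dir_B) (auto simp: W_def)
      then have "F (M k (B (s - 1 + norm p) p)) = p"
        using F2[OF G2[OF p le]] n by (simp add: inner_Mk MN)
      then show ?thesis using fq G2[OF p le] False by (simp add: G_def A_def)
    qed
  qed
  have "homeomorphic_maps (subtopology X (q ` A)) (top_of_set W) f G"
    unfolding homeomorphic_maps_def using f G FG GF fq by auto
  then have "subtopology X (q ` A) homeomorphic_space top_of_set W"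
    unfolding homeomorphic_space_def by blast
  moreover have "q x0 \<in> q ` A" using x0 rim1 by (auto simp: A_def)
  ultimately show ?thesis using opU \<open>open W\<close> by blast
qed

lemma surface_X: "surface X"
  unfolding surface_def
proof (intro conjI ballI)
  have "P \<noteq> {}"
  proof (cases "I = {}")
    case True
    then show ?thesis by (simp add: punctured_sphere_def)
  next
    case False
    then obtain k where k: "k \<in> I" by blast
    have "rim (c k) (t k) \<noteq> {}" using rim_nonempty unit[OF k] range[OF k] by blast
    then show ?thesis using rim_subset_P[OF k] by blast
  qed
  then show "topspace X \<noteq> {}" using topspace_X by simp
  fix z assume "z \<in> topspace X"
  then obtain x where x: "x \<in> P" "z = q x" using topspace_X by auto
  show "\<exists>U (W :: (real^2) set). openin X U \<and> z \<in> U \<and> open W \<and>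
    subtopology X U homeomorphic_space top_of_set W"
    using homeomorphic_interior[OF x(1)] homeomorphic_rim unfolding x(2) by blast
qed (fact compact_X connected_X Hausdorff_X)+

end

section \<open>Existence of gluings\<close>

lemma quotient_topology_exists:
  fixes Y :: "'a topology" and q :: "'a \<Rightarrow> 'b"
  obtains X where "quotient_map Y X q"
proof -
  define op where "op U \<longleftrightarrow> U \<subseteq> q ` topspace Y \<and> openin Y {x \<in> topspace Y. q x \<in> U}" for U
  have "istopology op"
    unfolding istopology_def
  proof (intro conjI allI impI)
    fix S T assume "op S" "op T"
    moreover have "{x \<in> topspace Y. q x \<in> S \<inter> T} = {x \<in> topspace Y. q x \<in> S} \<inter> {x \<in> topspace Y. q x \<in> T}"
      by auto
    ultimately show "op (S \<inter> T)" by (auto simp: op_def)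
  next
    fix \<K> assume *: "\<forall>K\<in>\<K>. op K"
    have "{x \<in> topspace Y. q x \<in> \<Union>\<K>} = (\<Union>K\<in>\<K>. {x \<in> topspace Y. q x \<in> K})" by auto
    then show "op (\<Union>\<K>)" using * by (auto simp: op_def)
  qed
  then have open_iff: "openin (topology op) = op" by (rule topology_inverse')
  moreover have "op (q ` topspace Y)"
  proof -
    have "{x \<in> topspace Y. q x \<in> q ` topspace Y} = topspace Y" by auto
    then show ?thesis by (simp add: op_def)
  qed
  then have "topspace (topology op) = q ` topspace Y"
    unfolding topspace_def[of "topology op"] open_iff by (auto simp: op_def)
  ultimately have "quotient_map Y (topology op) q"
    by (simp add: quotient_map_def op_def)
  then show ?thesis by (rule that)
qed

text \<open>Every point lies on at most one rim, so gluing twice in a row returns to the start and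
  the relation is an equivalence. Choosing representatives realizes the quotient on points of
  \<open>real^3\<close>, the type used in the final statement.\<close>

lemma (in cap_pairing) gluing_exists:
  obtains q :: "real^3 \<Rightarrow> real^3" and X where "cap_gluing I c t flip M q X"
proof -
  define r where "r x y \<longleftrightarrow> x = y \<or> (\<exists>k\<in>I. x \<in> rim (c k) (t k) \<and> y = M k x)" for x y
  have sym: "r y x" if "r x y" for x y
    using that M_rim M_M flip unfolding r_def by metis
  have trans: "r x z" if "r x y" "r y z" for x y z
  proof -
    have "x = z" if "k \<in> I" "x \<in> rim (c k) (t k)" "l \<in> I" "M k x \<in> rim (c l) (t l)" "z = M l (M k x)" for k l
    proof -
      have "l = flip k" using rim_unique M_rim that flip by metis
      then show ?thesis using that M_M by simp
    qed
    then show ?thesis using \<open>r x y\<close> \<open>r y z\<close> unfolding r_def by blast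
  qed
  define q where "q x = (SOME y. r x y)" for x
  have "q x = q y \<longleftrightarrow> r x y" for x y
  proof
    assume "r x y"
    then have "r x = r y" using sym trans by blast
    then show "q x = q y" by (simp add: q_def)
  next
    assume "q x = q y"
    moreover have "r z (q z)" for z unfolding q_def by (rule someI[of _ z]) (simp add: r_def)
    ultimately show "r x y" using sym trans by metis
  qed
  moreover obtain X where "quotient_map (top_of_set P) X q" using quotient_topology_exists .
  ultimately have "cap_gluing I c t flip M q X"
    by unfold_locales (auto simp: r_def)
  then show ?thesis by (rule that)
qed

text \<open>\<open>sphere_with_handles\<close> lists each handle once and glues in both directions;
  the locale lists it twice, with one direction each. \<open>J\<close> selects one cap of each pair,
  and the index \<open>flip k\<close> turns one form into the other.\<close>

lemma (in cap_gluing) sphere_with_handles_X: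
  assumes J: "I = J \<union> flip ` J" "J \<inter> flip ` J = {}"
    and R: "\<And>k. k \<in> J \<Longrightarrow> rotoinversion_matrix (R k) \<and> M k = (*v) (R k)"
  shows "sphere_with_handles (card J) X"
proof -
  have "finite J" and JI: "J \<subseteq> I" using fin J by auto
  then obtain e where e: "bij_betw e {..<card J} J"
    by (metis bij_betw_from_nat_into_finite)
  have eJ: "e i \<in> J" "e i \<in> I" "flip (e i) \<in> I" if "i < card J" for i
    using bij_betwE[OF e] that JI flip by auto
  have Rc: "R (e i) *v c (e i) = c (flip (e i))" if "i < card J" for i
    using eJ[OF that] M_c R by metis
  have ne: "e i \<noteq> flip (e j)" if "i < card J" "j < card J" for i j
    using eJ that J by blast
  have inj: "e i \<noteq> e j" "flip (e i) \<noteq> flip (e j)" if "i < card J" "j < card J" "i \<noteq> j" for i j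
  proof -
    show "e i \<noteq> e j" using bij_betw_imp_inj_on[OF e] that by (auto simp: inj_on_def)
    then show "flip (e i) \<noteq> flip (e j)" using flip(3) by metis
  qed
  have J_eq: "J = e ` {..<card J}" using bij_betw_imp_surj_on[OF e] by simp
  have P: "P = sphere 0 1 - (\<Union>i<card J. open_cap (c (e i)) (t (e i)) \<union> open_cap (R (e i) *v c (e i)) (t (e i)))"
  proof -
    have "(\<Union>k\<in>I. open_cap (c k) (t k)) =
      (\<Union>k\<in>J. open_cap (c k) (t k) \<union> open_cap (c (flip k)) (t (flip k)))"
      unfolding J(1) by blast
    also have "\<dots> = (\<Union>i<card J. open_cap (c (e i)) (t (e i)) \<union> open_cap (c (flip (e i))) (t (e i)))"
      by (subst J_eq) (simp add: flip)
    finally show ?thesis unfolding punctured_sphere_def using Rc by simp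
  qed
  have glue: "q x = q y \<longleftrightarrow> x = y \<or> (\<exists>i<card J. (x \<in> rim (c (e i)) (t (e i)) \<and> y = R (e i) *v x) \<or>
      (y \<in> rim (c (e i)) (t (e i)) \<and> x = R (e i) *v y))" if "x \<in> P" "y \<in> P" for x y
  proof -
    have "(\<exists>k\<in>I. x \<in> rim (c k) (t k) \<and> y = M k x) \<longleftrightarrow>
      (\<exists>k\<in>J. x \<in> rim (c k) (t k) \<and> y = M k x \<or> x \<in> rim (c (flip k)) (t (flip k)) \<and> y = M (flip k) x)"
      unfolding J(1) by blast
    also have "\<dots> \<longleftrightarrow> (\<exists>k\<in>J. x \<in> rim (c k) (t k) \<and> y = M k x \<or> y \<in> rim (c k) (t k) \<and> x = M k y)"
    proof -
      have "x \<in> rim (c (flip k)) (t (flip k)) \<and> y = M (flip k) x \<longleftrightarrow> y \<in> rim (c k) (t k) \<and> x = M k y"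
        if "k \<in> J" for k
        using M_rim[of k y] M_rim[of "flip k" x] M_M[of k] M_M'[of k] flip[of k] JI that by auto
      then show ?thesis by blast
    qed
    also have "\<dots> \<longleftrightarrow> (\<exists>i<card J. (x \<in> rim (c (e i)) (t (e i)) \<and> y = R (e i) *v x) \<or>
      (y \<in> rim (c (e i)) (t (e i)) \<and> x = R (e i) *v y))"
      using R eJ by (subst J_eq) auto
    finally show ?thesis using q_eq[OF that] by simp
  qed
  show ?thesis
    unfolding sphere_with_handles_def Let_def
  proof (intro exI[of _ "c \<circ> e"] exI[of _ "t \<circ> e"] exI[of _ "R \<circ> e"] exI[of _ q] conjI allI impI)
    fix i assume i: "i < card J"
    show "norm ((c \<circ> e) i) = 1" "- 1 < (t \<circ> e) i" "(t \<circ> e) i < 1" "rotoinversion_matrix ((R \<circ> e) i)"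
      using unit range R eJ[OF i] by auto
    fix j assume j: "j < card J"
    show "disjnt (cap ((c \<circ> e) i) ((t \<circ> e) i)) (cap ((R \<circ> e) j *v (c \<circ> e) j) ((t \<circ> e) j))"
      using disj[OF eJ(2)[OF i] eJ(3)[OF j] ne[OF i j]] Rc[OF j] flip by simp
    assume ij: "i \<noteq> j"
    show "disjnt (cap ((c \<circ> e) i) ((t \<circ> e) i)) (cap ((c \<circ> e) j) ((t \<circ> e) j))"
      using disj[OF eJ(2)[OF i] eJ(2)[OF j] inj(1)[OF i j ij]] by simp
    show "disjnt (cap ((R \<circ> e) i *v (c \<circ> e) i) ((t \<circ> e) i)) (cap ((R \<circ> e) j *v (c \<circ> e) j) ((t \<circ> e) j))"
      using disj[OF eJ(3)[OF i] eJ(3)[OF j] inj(2)[OF i j ij]] Rc[OF i] Rc[OF j] flip by simp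
  next
    show "quotient_map (top_of_set (sphere 0 1 - (\<Union>i<card J. open_cap ((c \<circ> e) i) ((t \<circ> e) i) \<union>
      open_cap ((R \<circ> e) i *v (c \<circ> e) i) ((t \<circ> e) i)))) X q"
      using quot unfolding P by simp
  next
    show "\<forall>x\<in>sphere 0 1 - (\<Union>i<card J. open_cap ((c \<circ> e) i) ((t \<circ> e) i) \<union> open_cap ((R \<circ> e) i *v (c \<circ> e) i) ((t \<circ> e) i)).
      \<forall>y\<in>sphere 0 1 - (\<Union>i<card J. open_cap ((c \<circ> e) i) ((t \<circ> e) i) \<union> open_cap ((R \<circ> e) i *v (c \<circ> e) i) ((t \<circ> e) i)).
        (q x = q y) = (x = y \<or> (\<exists>i<card J. x \<in> rim ((c \<circ> e) i) ((t \<circ> e) i) \<and> y = (R \<circ> e) i *v x \<or>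
          y \<in> rim ((c \<circ> e) i) ((t \<circ> e) i) \<and> x = (R \<circ> e) i *v y))"
      unfolding comp_apply P[symmetric] using glue by blast
  qed
qed

text \<open>A pair \<open>(i, j)\<close> stands for the half-edge from vertex \<open>i\<close>
  towards \<open>j\<close>, which \<open>w\<close> traverses from the vertex to the tip. Apart from
  identical positions, \<open>cross\<close> admits two coincidences only, a common starting vertex
  and the tips of the two halves of an edge; injectivity and disjointness follow from it.
  \<open>n \<ge> 2\<close> gives every vertex a half-edge, which ties \<open>p i\<close> to
  \<open>X\<close>.\<close>

lemma complete_graph_embeddable:
  fixes w :: "nat \<times> nat \<Rightarrow> real \<Rightarrow> 'a" and \<sigma> :: "nat \<times> nat \<Rightarrow> real"
  defines "H \<equiv> \<lambda>n::nat. {k. fst k < n \<and> snd k < n \<and> fst k \<noteq> snd k}"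
  assumes n: "n \<ge> 2"
    and pos: "\<And>k. k \<in> H n \<Longrightarrow> \<sigma> k > 0"
    and cont: "\<And>k. k \<in> H n \<Longrightarrow> continuous_map (top_of_set {0..\<sigma> k}) X (w k)"
    and start: "\<And>k. k \<in> H n \<Longrightarrow> w k 0 = p (fst k)"
    and meet: "\<And>k. k \<in> H n \<Longrightarrow> w k (\<sigma> k) = w (prod.swap k) (\<sigma> (prod.swap k))"
    and cross: "\<And>k l s r. k \<in> H n \<Longrightarrow> l \<in> H n \<Longrightarrow> 0 \<le> s \<Longrightarrow> s \<le> \<sigma> k \<Longrightarrow> 0 \<le> r \<Longrightarrow> r \<le> \<sigma> l \<Longrightarrow>
      w k s = w l r \<Longrightarrow> k = l \<and> s = r \<or> s = 0 \<and> r = 0 \<and> fst k = fst l \<or>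
        s = \<sigma> k \<and> r = \<sigma> l \<and> l = prod.swap k"
  shows "graph_embeddable {..<n} {e. e \<subseteq> {..<n} \<and> card e = 2} X"
proof -
  let ?E = "{e. e \<subseteq> {..<n} \<and> card e = 2}"
  define key where "key e = (Min e, Max e)" for e :: "nat set"
  have key: "key e \<in> H n \<and> prod.swap (key e) \<in> H n \<and> e = {fst (key e), snd (key e)}" if e: "e \<in> ?E" for e
  proof -
    obtain x y where "e = {x, y}" "x \<noteq> y" using e by (auto simp: card_2_iff)
    then show ?thesis using e by (cases "x < y") (auto simp: key_def H_def)
  qed
  have other: "\<exists>k\<in>H n. fst k = i" if "i < n" for i
  proof (cases "i = 0")
    case True
    then show ?thesis using n by (intro bexI[of _ "(0, 1)"]) (auto simp: H_def)
  next
    case False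
    then show ?thesis using n that by (intro bexI[of _ "(i, 0)"]) (auto simp: H_def)
  qed
  \<comment> \<open>The half-edge of the smaller endpoint is run out to its tip, reached at time
    1/2, and then the other half-edge is run back from its tip.\<close>
  define \<gamma> where "\<gamma> e s = (if s \<le> 1/2 then w (key e) (2 * s * \<sigma> (key e))
    else w (prod.swap (key e)) ((2 - 2 * s) * \<sigma> (prod.swap (key e))))" for e s
  have half: "\<exists>k r. (k = key e \<or> k = prod.swap (key e)) \<and> k \<in> H n \<and> 0 < r \<and> r \<le> \<sigma> k \<and> \<gamma> e s = w k r"
    if "e \<in> ?E" "s \<in> {0<..<1}" for e s
  proof (cases "s \<le> 1/2")
    case True
    then show ?thesis using that key[OF that(1)] pos
      by (intro exI[of _ "key e"] exI[of _ "2 * s * \<sigma> (key e)"])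
        (auto simp: \<gamma>_def intro!: mult_left_le_one_le)
  next
    case False
    then show ?thesis using that key[OF that(1)] pos
      by (intro exI[of _ "prod.swap (key e)"] exI[of _ "(2 - 2 * s) * \<sigma> (prod.swap (key e))"])
        (auto simp: \<gamma>_def intro!: mult_left_le_one_le)
  qed
  have inj_p: "inj_on p {..<n}"
  proof (rule inj_onI)
    fix i j assume ij: "i \<in> {..<n}" "j \<in> {..<n}" "p i = p j"
    then obtain k l where "k \<in> H n" "fst k = i" "l \<in> H n" "fst l = j" using other by (meson lessThan_iff)
    then show "i = j" using cross[of k l 0 0] start[of k] start[of l] pos[of k] pos[of l] ij by auto
  qed
  have p_top: "p ` {..<n} \<subseteq> topspace X"
  proof safe
    fix i assume "i < n"
    then obtain k where k: "k \<in> H n" "fst k = i" using other by blast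
    have "w k 0 \<in> topspace X"
      using continuous_map_image_subset_topspace[OF cont[OF k(1)]] pos[OF k(1)] by auto
    then show "p i \<in> topspace X" using start k by auto
  qed
  have path: "pathin X (\<gamma> e)" if "e \<in> ?E" for e
  proof -
    define k l where "k = key e" and "l = prod.swap (key e)"
    have kl: "k \<in> H n" "l \<in> H n" using key[OF that] by (auto simp: k_def l_def)
    have "continuous_map (top_of_set {0..1}) X
      (\<lambda>s. if s \<le> 1/2 then w k (2 * s * \<sigma> k) else w l ((2 - 2 * s) * \<sigma> l))"
    proof (rule continuous_map_cases_le)
      have 1: "continuous_map (top_of_set {0..1/2}) (top_of_set {0..\<sigma> k}) (\<lambda>s. 2 * s * \<sigma> k)"
        using pos[OF kl(1)] by (auto intro!: continuous_intros mult_left_le_one_le)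
      have "{x \<in> topspace (top_of_set {0..1}). x \<le> 1/2} = {0..1/2::real}" by auto
      then show "continuous_map (subtopology (top_of_set {0..1}) {x \<in> topspace (top_of_set {0..1}). x \<le> 1/2}) X
        (\<lambda>s. w k (2 * s * \<sigma> k))"
        using continuous_map_compose[OF 1 cont[OF kl(1)]] by (simp add: subtopology_subtopology o_def)
      have 2: "continuous_map (top_of_set {1/2..1}) (top_of_set {0..\<sigma> l}) (\<lambda>s. (2 - 2 * s) * \<sigma> l)"
        using pos[OF kl(2)] by (auto intro!: continuous_intros mult_left_le_one_le)
      have "{x \<in> topspace (top_of_set {0..1}). 1/2 \<le> x} = {1/2..1::real}" by auto
      then show "continuous_map (subtopology (top_of_set {0..1}) {x \<in> topspace (top_of_set {0..1}). 1/2 \<le> x}) X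
        (\<lambda>s. w l ((2 - 2 * s) * \<sigma> l))"
        using continuous_map_compose[OF 2 cont[OF kl(2)]] by (simp add: subtopology_subtopology o_def)
      show "w k (2 * s * \<sigma> k) = w l ((2 - 2 * s) * \<sigma> l)" if "s = 1/2" for s
        unfolding that using meet[OF kl(1)] by (simp add: k_def l_def)
    qed auto
    then show ?thesis by (simp only: pathin_def \<gamma>_def[abs_def] k_def l_def)
  qed
  have inj_\<gamma>: "inj_on (\<gamma> e) {0..1}" if "e \<in> ?E" for e
  proof -
    define k l where "k = key e" and "l = prod.swap (key e)"
    have kl: "k \<in> H n" "l \<in> H n" "fst k \<noteq> fst l" "l = prod.swap k" "k \<noteq> l"
      using key[OF that] by (auto simp: k_def l_def H_def prod_eq_iff)
    have \<gamma>: "\<gamma> e s = (if s \<le> 1/2 then w k (2 * s * \<sigma> k) else w l ((2 - 2 * s) * \<sigma> l))" for s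
      by (simp add: \<gamma>_def k_def l_def)
    have pk: "\<sigma> k > 0" and pl: "\<sigma> l > 0" using pos kl by auto
    have k1: "0 \<le> 2 * s * \<sigma> k \<and> 2 * s * \<sigma> k \<le> \<sigma> k" if "0 \<le> s" "s \<le> 1/2" for s
      using that pk by (auto intro!: mult_left_le_one_le)
    \<comment> \<open>Strict on the right, since the tip at time 1/2 is counted with the first half;
      this excludes the coincidence of tips in \<open>mixed\<close>.\<close>
    have l1: "0 \<le> (2 - 2 * s) * \<sigma> l \<and> (2 - 2 * s) * \<sigma> l < \<sigma> l" if "1/2 < s" "s \<le> 1" for s
      using that pl by auto
    have mixed: "\<gamma> e s \<noteq> \<gamma> e r" if "0 \<le> s" "s \<le> 1/2" "1/2 < r" "r \<le> 1" for s r
      using cross[of k l "2 * s * \<sigma> k" "(2 - 2 * r) * \<sigma> l"] kl k1[of s] l1[of r] that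
      by (auto simp: \<gamma>)
    have fst_half: "s = r" if "0 \<le> s" "s \<le> 1/2" "0 \<le> r" "r \<le> 1/2" "\<gamma> e s = \<gamma> e r" for s r
      using cross[of k k "2 * s * \<sigma> k" "2 * r * \<sigma> k"] kl k1[of s] k1[of r] that pk
      by (auto simp: \<gamma>)
    have snd_half: "s = r" if "1/2 < s" "s \<le> 1" "1/2 < r" "r \<le> 1" "\<gamma> e s = \<gamma> e r" for s r
      using cross[of l l "(2 - 2 * s) * \<sigma> l" "(2 - 2 * r) * \<sigma> l"] kl l1[of s] l1[of r] that pl
      by (auto simp: \<gamma>)
    show ?thesis
    proof (rule inj_onI)
      fix s r :: real assume "s \<in> {0..1}" "r \<in> {0..1}" and eq: "\<gamma> e s = \<gamma> e r"
      then show "s = r"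
        using mixed[of s r] mixed[of r s] fst_half[of s r] snd_half[of s r]
        by (cases "s \<le> 1/2"; cases "r \<le> 1/2") auto
    qed
  qed
  have ends: "{\<gamma> e 0, \<gamma> e 1} = p ` e" if "e \<in> ?E" for e
  proof -
    have "p ` e = {p (fst (key e)), p (snd (key e))}" using key[OF that] by (metis image_empty image_insert)
    then show ?thesis using key[OF that] start[of "key e"] start[of "prod.swap (key e)"]
      by (simp add: \<gamma>_def)
  qed
  have avoid: "disjnt (\<gamma> e ` {0<..<1}) (p ` {..<n})" if "e \<in> ?E" for e
  proof -
    have False if s: "s \<in> {0<..<1}" and i: "i \<in> {..<n}" and eq: "\<gamma> e s = p i" for s i
    proof -
      obtain k r where k: "k \<in> H n" "0 < r" "r \<le> \<sigma> k" "\<gamma> e s = w k r"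
        using half[OF \<open>e \<in> ?E\<close> s] by blast
      obtain l where l: "l \<in> H n" "fst l = i" using other i by blast
      show False using cross[of k l r 0] k l eq start[OF l(1)] pos[OF l(1)] by auto
    qed
    then show ?thesis unfolding disjnt_iff by blast
  qed
  have disj: "disjnt (\<gamma> e ` {0<..<1}) (\<gamma> e' ` {0<..<1})" if "e \<in> ?E" "e' \<in> ?E" "e \<noteq> e'" for e e'
  proof -
    have False if s: "s \<in> {0<..<1}" and s': "s' \<in> {0<..<1}" and eq: "\<gamma> e s = \<gamma> e' s'" for s s'
    proof -
      obtain k r where k: "k = key e \<or> k = prod.swap (key e)" "k \<in> H n" "0 < r" "r \<le> \<sigma> k" "\<gamma> e s = w k r"
        using half[OF \<open>e \<in> ?E\<close> s] by blast
      obtain l r' where l: "l = key e' \<or> l = prod.swap (key e')" "l \<in> H n" "0 < r'" "r' \<le> \<sigma> l" "\<gamma> e' s' = w l r'"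
        using half[OF \<open>e' \<in> ?E\<close> s'] by blast
      have "k = l \<or> l = prod.swap k" using cross[of k l r r'] k l eq by auto
      then have "{fst k, snd k} = {fst l, snd l}" by auto
      moreover have "{fst k, snd k} = {fst (key e), snd (key e)}" using k(1) by auto
      moreover have "{fst l, snd l} = {fst (key e'), snd (key e')}" using l(1) by auto
      ultimately show False
        using key[OF \<open>e \<in> ?E\<close>] key[OF \<open>e' \<in> ?E\<close>] \<open>e \<noteq> e'\<close> by argo
    qed
    then show ?thesis unfolding disjnt_iff by blast
  qed
  show ?thesis
    unfolding graph_embeddable_def
    using inj_p p_top path inj_\<gamma> ends avoid disj by (intro exI[of _ p] exI[of _ \<gamma>]) blast
qed

section \<open>Drawing the half-edges\<close>

text \<open>As \<open>\<tau>\<close> tends to 1, the cap around \<open>a\<close> shrinks to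
  \<open>a\<close> and leaves \<open>K\<close>: the maximum of \<open>a \<bullet> x\<close> on
  \<open>K\<close> is below 1, because between unit vectors the value 1 forces
  \<open>x = a\<close>.\<close>

lemma eventually_inner_less:
  fixes a :: "'a::real_inner"
  assumes "norm a = 1" "compact K" "\<And>x. x \<in> K \<Longrightarrow> norm x = 1" "a \<notin> K"
  shows "\<forall>\<^sub>F \<tau> in at_left (1::real). \<forall>x\<in>K. a \<bullet> x < \<tau>"
proof (cases "K = {}")
  case False
  have "continuous_on K (\<lambda>x. a \<bullet> x)" by (intro continuous_intros)
  then obtain x0 where x0: "x0 \<in> K" "\<And>x. x \<in> K \<Longrightarrow> a \<bullet> x \<le> a \<bullet> x0"
    using continuous_attains_sup[OF \<open>compact K\<close> False] by blast
  have "a \<bullet> x0 \<noteq> 1"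
  proof
    assume "a \<bullet> x0 = 1"
    moreover have "a \<bullet> a = 1" "x0 \<bullet> x0 = 1" using assms x0(1) by (simp_all add: norm_eq_1)
    ultimately have "(a - x0) \<bullet> (a - x0) = 0"
      by (simp add: inner_diff_left inner_diff_right inner_commute)
    then show False using \<open>a \<notin> K\<close> x0(1) by simp
  qed
  moreover have "a \<bullet> x0 \<le> 1" using norm_cauchy_schwarz[of a x0] assms x0(1) by simp
  ultimately have "\<forall>\<^sub>F \<tau> in at_left 1. a \<bullet> x0 < \<tau>"
    using eventually_at_left_real[of "a \<bullet> x0" 1] by (auto elim: eventually_mono)
  then show ?thesis by (rule eventually_mono) (use x0(2) in force)
qed simp

text \<open>A common point \<open>x\<close> gives
  \<open>(a + b) \<bullet> x \<ge> 2 * \<tau>\<close>, while the left side is at most the norm of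
  \<open>a + b\<close>, which is below 2 by the parallelogram law.\<close>

lemma eventually_disjnt_cap:
  assumes "norm a = 1" "norm b = 1" "a \<noteq> b"
  shows "\<forall>\<^sub>F \<tau> in at_left 1. disjnt (cap a \<tau>) (cap b \<tau>)"
proof -
  have "a \<bullet> a = 1" "b \<bullet> b = 1" using assms by (simp_all add: norm_eq_1)
  then have "(norm (a + b))\<^sup>2 + (norm (a - b))\<^sup>2 = 4"
    by (simp add: power2_norm_eq_inner inner_add_left inner_add_right inner_diff_left inner_diff_right)
  moreover have "(norm (a - b))\<^sup>2 > 0" using assms by simp
  ultimately have "(norm (a + b))\<^sup>2 < 4" by linarith
  then have "(norm (a + b))\<^sup>2 < 2\<^sup>2" by simp
  then have "norm (a + b) / 2 < 1" using power2_less_imp_less[of "norm (a + b)" 2] by simp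
  then have "\<forall>\<^sub>F \<tau> in at_left 1. norm (a + b) / 2 < \<tau>"
    using eventually_at_left_real[of "norm (a + b) / 2" 1] by (auto elim: eventually_mono)
  then show ?thesis
  proof (rule eventually_mono)
    fix \<tau> assume \<tau>: "norm (a + b) / 2 < \<tau>"
    have False if "norm x = 1" "\<tau> \<le> a \<bullet> x" "\<tau> \<le> b \<bullet> x" for x
      using norm_cauchy_schwarz[of "a + b" x] that \<tau> by (simp add: inner_add_left)
    then show "disjnt (cap a \<tau>) (cap b \<tau>)" by (auto simp: disjnt_iff cap_def)
  qed
qed

text \<open>Finds where to cut a half-edge that might meet the rim of its own cap several times: at
  the least element of the compact set of times with \<open>f\<close> at least
  \<open>\<tau>\<close>.\<close>

lemma first_hit:
  fixes f :: "real \<Rightarrow> real"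
  assumes "continuous_on {0..1} f" "f 0 < \<tau>" "\<tau> \<le> f 1"
  obtains \<sigma> where "0 < \<sigma>" "\<sigma> \<le> 1" "f \<sigma> = \<tau>" "\<And>s. 0 \<le> s \<Longrightarrow> s < \<sigma> \<Longrightarrow> f s < \<tau>"
proof -
  define Z where "Z = {0..1} \<inter> f -` {\<tau>..}"
  have "closed Z" unfolding Z_def using assms(1) by (intro continuous_closed_preimage) auto
  moreover have "bounded Z" unfolding Z_def by (rule bounded_subset[of "{0..1}"]) auto
  ultimately have "compact Z" by (simp add: compact_eq_bounded_closed)
  moreover have "1 \<in> Z" using assms by (simp add: Z_def)
  ultimately obtain \<sigma> where \<sigma>: "\<sigma> \<in> Z" "\<And>s. s \<in> Z \<Longrightarrow> \<sigma> \<le> s"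
    using compact_attains_inf[of Z] by blast
  have less: "f s < \<tau>" if "0 \<le> s" "s < \<sigma>" for s
    using \<sigma>(2)[of s] \<sigma>(1) that by (force simp: Z_def)
  have "\<exists>s\<ge>0. s \<le> \<sigma> \<and> f s = \<tau>"
    using \<sigma>(1) assms by (intro IVT') (auto simp: Z_def intro: continuous_on_subset)
  then obtain s where s: "0 \<le> s" "s \<le> \<sigma>" "f s = \<tau>" by blast
  then have f\<sigma>: "f \<sigma> = \<tau>" using less[of s] by (cases "s = \<sigma>") auto
  have "0 < \<sigma>" "\<sigma> \<le> 1"
    using f\<sigma> assms(2) \<sigma>(1) by (auto simp: Z_def less_le)
  then show ?thesis using f\<sigma> less by (rule that)
qed

text \<open>The central projection of the segment in the plane \<open>z = 1\<close> from the vertex \<open>(i, 0)\<close> to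
  \<open>(i + j / n, 1)\<close>. For \<open>j < n\<close> the segments of different vertices lie in disjoint strips.\<close>
definition half_arc :: "nat \<Rightarrow> nat \<times> nat \<Rightarrow> real \<Rightarrow> real^3" where
  "half_arc n k s = sgn (vector [real (fst k) + s * real (snd k) / real n, s, 1])"

lemma vector_1_neq_0: "(vector [x, y, 1] :: real^3) \<noteq> 0"
  by (metis vector_3(3) zero_index zero_neq_one)

lemma norm_half_arc [simp]: "norm (half_arc n k s) = 1"
  by (simp add: half_arc_def norm_sgn vector_1_neq_0)

text \<open>Vectors with the same direction are proportional, and the common third coordinate 1
  fixes the factor: central projection is injective on the plane.\<close>

lemma sgn_vector_1_eq:
  assumes "sgn (vector [x, y, 1] :: real^3) = sgn (vector [x', y', 1])"
  shows "x = x' \<and> y = y'"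
proof -
  let ?p = "vector [x, y, 1] :: real^3" and ?q = "vector [x', y', 1] :: real^3"
  have "?p = norm ?p *\<^sub>R sgn ?p" by (simp add: sgn_div_norm vector_1_neq_0)
  also have "\<dots> = norm ?p *\<^sub>R sgn ?q" using assms by simp
  finally have p: "?p = (norm ?p / norm ?q) *\<^sub>R ?q" by (simp add: sgn_div_norm divide_inverse)
  have "?p $ 3 = ((norm ?p / norm ?q) *\<^sub>R ?q) $ 3" using p by (rule arg_cong)
  then have "norm ?p / norm ?q = 1" unfolding vector_scaleR_component by (simp add: vector_1_neq_0)
  then have "?p = ?q" using p unfolding \<open>norm ?p / norm ?q = 1\<close> by simp
  then have "?p $ 1 = ?q $ 1" "?p $ 2 = ?q $ 2" by (rule arg_cong)+
  then show ?thesis by simp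
qed

text \<open>The second plane coordinate gives \<open>s = r\<close>. The offset from the vertex is at
  least 0 and less than 1, so the first coordinate determines the integer \<open>fst k\<close>, and
  then also \<open>snd k\<close> unless \<open>s = 0\<close>.\<close>

lemma half_arc_eq:
  assumes "half_arc n k s = half_arc n l r" "0 \<le> s" "s \<le> 1" "snd k < n" "snd l < n"
  shows "s = r \<and> fst k = fst l \<and> (s = 0 \<or> snd k = snd l)"
proof -
  have eq: "real (fst k) + s * real (snd k) / real n = real (fst l) + r * real (snd l) / real n" "s = r"
    using sgn_vector_1_eq[of "real (fst k) + s * real (snd k) / real n" s] assms(1)
    by (auto simp: half_arc_def)
  have frac: "0 \<le> s * real (snd m) / real n \<and> s * real (snd m) / real n < 1" if "snd m < n" for m :: "nat \<times> nat"
    using assms that mult_left_le_one_le[of "real (snd m)" s] by (simp add: divide_simps)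
  have "real (fst k) < real (fst l + 1)" "real (fst l) < real (fst k + 1)"
    using eq(1) frac[OF \<open>snd k < n\<close>] frac[OF \<open>snd l < n\<close>] unfolding eq(2) by simp_all
  then have "fst k = fst l" by (simp only: of_nat_less_iff)
  moreover have "s = 0 \<or> snd k = snd l" using eq calculation assms by auto
  ultimately show ?thesis using eq by simp
qed

lemma continuous_half_arc: "continuous_on S (half_arc n k)"
proof -
  have "continuous_on S (\<lambda>s. vector [real (fst k) + s * real (snd k) / real n, s, 1] :: real^3)"
  proof -
    have "vector [x, y, z] = x *\<^sub>R axis 1 1 + y *\<^sub>R axis 2 1 + z *\<^sub>R (axis 3 1 :: real^3)" for x y z
      by (simp add: vec_eq_iff forall_3 axis_def)
    then show ?thesis unfolding divide_inverse by (simp only:) (intro continuous_intros)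
  qed
  then show ?thesis unfolding half_arc_def[abs_def] by (intro continuous_on_sgn) (auto simp: vector_1_neq_0)
qed

section \<open>Assembling the surface and the drawing\<close>

lemma transpose_orthogonal_cancel:
  assumes "orthogonal_matrix (A :: real^'n^'n)"
  shows "transpose A *v (A *v x) = x" "A *v (transpose A *v x) = x"
  using assms by (simp_all add: orthogonal_matrix_def matrix_vector_mul_assoc del: transpose_matrix_vector)

lemma complete_graph_surface_embedding:
  assumes n: "n \<ge> 2"
  obtains X :: "(real^3) topology"
  where "surface X" "has_euler_genus X (n * (n - 1))"
    "graph_embeddable {..<n} {e. e \<subseteq> {..<n} \<and> card e = 2} X"
proof -
  define H where "H = {k :: nat \<times> nat. fst k < n \<and> snd k < n \<and> fst k \<noteq> snd k}"
  have "H \<subseteq> {..<n} \<times> {..<n}" by (auto simp: H_def)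
  then have finH: "finite H" by (rule finite_subset) simp
  have swapH: "prod.swap k \<in> H" if "k \<in> H" for k using that by (auto simp: H_def)
  have H: "snd k < n" "fst k < n" "fst k \<noteq> snd k" if "k \<in> H" for k using that by (auto simp: H_def)
  define \<beta> where "\<beta> = half_arc n"
  have n\<beta> [simp]: "norm (\<beta> k s) = 1" for k s by (simp add: \<beta>_def)
  have \<beta>_eq: "s = r \<and> fst k = fst l \<and> (s = 0 \<or> k = l)"
    if "k \<in> H" "l \<in> H" "\<beta> k s = \<beta> l r" "0 \<le> s" "s \<le> 1" for k l s r
    using half_arc_eq[of n k s l r] that H by (auto simp: \<beta>_def prod_eq_iff)
  have \<beta>_start: "\<beta> k 0 = \<beta> l 0" if "fst k = fst l" for k l
    using that by (simp add: \<beta>_def half_arc_def)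
  have cont_\<beta>: "continuous_on S (\<beta> k)" for S k
    by (simp add: \<beta>_def continuous_half_arc)
  define c where "c k = \<beta> k 1" for k
  \<comment> \<open>All requirements hold for \<open>\<tau>\<close> close enough to 1, so one height
    serves all caps; in particular the two caps of a handle are congruent, as an isometric gluing
    demands.\<close>
  have "\<forall>\<^sub>F \<tau> in at_left (1::real). \<tau> \<in> {0<..<1} \<and> (\<forall>k\<in>H. c k \<bullet> \<beta> k 0 < \<tau>) \<and>
    (\<forall>k\<in>H. \<forall>l\<in>H. k \<noteq> l \<longrightarrow> disjnt (cap (c k) \<tau>) (cap (c l) \<tau>)) \<and>
    (\<forall>k\<in>H. \<forall>l\<in>H. k \<noteq> l \<longrightarrow> (\<forall>s\<in>{0..1}. c k \<bullet> \<beta> l s < \<tau>))"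
  proof (intro eventually_conj eventually_ball_finite finH ballI)
    show "\<forall>\<^sub>F \<tau> in at_left (1::real). \<tau> \<in> {0<..<1}"
      by (rule eventually_at_left_real) simp
    fix k assume k: "k \<in> H"
    have "c k \<noteq> \<beta> k 0" using \<beta>_eq[OF k k, of 1 0] by (auto simp: c_def)
    then have "\<forall>\<^sub>F \<tau> in at_left 1. \<forall>x\<in>{\<beta> k 0}. c k \<bullet> x < \<tau>"
      by (intro eventually_inner_less) (auto simp: c_def)
    then show "\<forall>\<^sub>F \<tau> in at_left 1. c k \<bullet> \<beta> k 0 < \<tau>" by simp
    fix l assume l: "l \<in> H"
    have ne: "c k \<noteq> \<beta> l s" if "k \<noteq> l" for s
      using \<beta>_eq[OF k l, of 1 s] that by (auto simp: c_def)
    show "\<forall>\<^sub>F \<tau> in at_left 1. k \<noteq> l \<longrightarrow> disjnt (cap (c k) \<tau>) (cap (c l) \<tau>)"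
      using eventually_disjnt_cap[of "c k" "c l"] ne[of 1] by (cases "k = l") (auto simp: c_def)
    show "\<forall>\<^sub>F \<tau> in at_left 1. k \<noteq> l \<longrightarrow> (\<forall>s\<in>{0..1}. c k \<bullet> \<beta> l s < \<tau>)"
    proof (cases "k = l")
      case False
      have "\<forall>\<^sub>F \<tau> in at_left 1. \<forall>x\<in>\<beta> l ` {0..1}. c k \<bullet> x < \<tau>"
        using ne[OF False] by (intro eventually_inner_less compact_continuous_image cont_\<beta>) (auto simp: c_def)
      then show ?thesis by (simp add: False)
    qed simp
  qed
  from eventually_happens'[OF trivial_limit_at_left_real this]
  obtain \<tau> where \<tau>: "0 < \<tau>" "\<tau> < 1" and start: "\<And>k. k \<in> H \<Longrightarrow> c k \<bullet> \<beta> k 0 < \<tau>"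
    and disj: "\<And>k l. k \<in> H \<Longrightarrow> l \<in> H \<Longrightarrow> k \<noteq> l \<Longrightarrow> disjnt (cap (c k) \<tau>) (cap (c l) \<tau>)"
    and off: "\<And>k l s. k \<in> H \<Longrightarrow> l \<in> H \<Longrightarrow> k \<noteq> l \<Longrightarrow> 0 \<le> s \<Longrightarrow> s \<le> 1 \<Longrightarrow> c k \<bullet> \<beta> l s < \<tau>"
    by auto
  \<comment> \<open>\<open>\<sigma> k\<close> is the time at which the arc first reaches the rim of
    its own cap; what follows on the arc is discarded.\<close>
  have "\<exists>\<sigma>. 0 < \<sigma> \<and> \<sigma> \<le> 1 \<and> c k \<bullet> \<beta> k \<sigma> = \<tau> \<and> (\<forall>s. 0 \<le> s \<and> s < \<sigma> \<longrightarrow> c k \<bullet> \<beta> k s < \<tau>)" if k: "k \<in> H" for k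
  proof -
    have "c k \<bullet> \<beta> k 1 = 1" by (metis c_def n\<beta> norm_eq_1)
    then have "\<tau> \<le> c k \<bullet> \<beta> k 1" using \<tau> by simp
    moreover have "continuous_on {0..1} (\<lambda>s. c k \<bullet> \<beta> k s)" by (intro continuous_intros cont_\<beta>)
    ultimately show ?thesis using first_hit[of "\<lambda>s. c k \<bullet> \<beta> k s" \<tau>] start[OF k] by metis
  qed
  then obtain \<sigma> where \<sigma>: "\<And>k. k \<in> H \<Longrightarrow> 0 < \<sigma> k" "\<And>k. k \<in> H \<Longrightarrow> \<sigma> k \<le> 1"
    "\<And>k. k \<in> H \<Longrightarrow> c k \<bullet> \<beta> k (\<sigma> k) = \<tau>"
    "\<And>k s. k \<in> H \<Longrightarrow> 0 \<le> s \<Longrightarrow> s < \<sigma> k \<Longrightarrow> c k \<bullet> \<beta> k s < \<tau>"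
    by metis
  define J where "J = {k \<in> H. fst k < snd k}"
  have "\<exists>R. rotoinversion_matrix R \<and> R *v c k = c (prod.swap k) \<and>
    R *v \<beta> k (\<sigma> k) = \<beta> (prod.swap k) (\<sigma> (prod.swap k))" if "k \<in> H" for k
    using that \<tau> \<sigma>(3) swapH by (intro rotoinversion_matrix_exists[where t = \<tau>]) (auto simp: c_def)
  then obtain R where R: "\<And>k. k \<in> H \<Longrightarrow> rotoinversion_matrix (R k)"
    "\<And>k. k \<in> H \<Longrightarrow> R k *v c k = c (prod.swap k)"
    "\<And>k. k \<in> H \<Longrightarrow> R k *v \<beta> k (\<sigma> k) = \<beta> (prod.swap k) (\<sigma> (prod.swap k))"
    by metis
  \<comment> \<open>\<open>R k\<close> and \<open>R (prod.swap k)\<close> are chosen independently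
    and need not be inverse to each other. Keeping one and using its transpose for the partner makes
    the two gluing maps inverse.\<close>
  define N where "N k = (if fst k < snd k then R k else transpose (R (prod.swap k)))" for k
  have orthR: "orthogonal_matrix (R k)" if "k \<in> H" for k
    using R(1)[OF that] by (simp add: rotoinversion_matrix_def)
  have orthN: "orthogonal_matrix (N k)" if "k \<in> H" for k
    using orthR[OF that] orthR[OF swapH[OF that]] by (simp add: N_def)
  have N: "N k *v c k = c (prod.swap k)" "N k *v \<beta> k (\<sigma> k) = \<beta> (prod.swap k) (\<sigma> (prod.swap k))"
    if k: "k \<in> H" for k
    using R(2,3)[OF k] R(2,3)[OF swapH[OF k]] transpose_orthogonal_cancel[OF orthR[OF swapH[OF k]]]
    by (auto simp: N_def simp del: transpose_matrix_vector) metis+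
  have NN: "N (prod.swap k) *v (N k *v x) = x" if "k \<in> H" for k x
    using H[OF that] transpose_orthogonal_cancel[OF orthR[OF that]]
      transpose_orthogonal_cancel[OF orthR[OF swapH[OF that]]] by (auto simp: N_def simp del: transpose_matrix_vector)
  interpret cp: cap_pairing H c "\<lambda>_. \<tau>" prod.swap "\<lambda>k. (*v) (N k)"
  proof
    fix k assume k: "k \<in> H"
    show "prod.swap k \<noteq> k" using H[OF k] by (auto simp: prod_eq_iff)
    show "orthogonal_transformation ((*v) (N k))"
      using orthN[OF k] by (simp add: orthogonal_transformation_matrix)
  qed (use finH \<tau> disj swapH N NN in \<open>auto simp: c_def\<close>)
  obtain q :: "real^3 \<Rightarrow> real^3" and X where "cap_gluing H c (\<lambda>_. \<tau>) prod.swap (\<lambda>k. (*v) (N k)) q X"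
    using cp.gluing_exists .
  then interpret cap_gluing H c "\<lambda>_. \<tau>" prod.swap "\<lambda>k. (*v) (N k)" q X .
  have le: "c l \<bullet> \<beta> k s \<le> \<tau>" if "k \<in> H" "l \<in> H" "0 \<le> s" "s \<le> \<sigma> k" for k l s
    using that off[of l k s] \<sigma>[of k] by (cases "l = k"; cases "s = \<sigma> k") (auto simp: less_imp_le)
  have \<beta>P: "\<beta> k s \<in> punctured_sphere H c (\<lambda>_. \<tau>)" if "k \<in> H" "0 \<le> s" "s \<le> \<sigma> k" for k s
    using le[OF that(1) _ that(2,3)] by (force simp: punctured_sphere_def open_cap_def)
  have on_rim: "l = k \<and> s = \<sigma> k" if "k \<in> H" "l \<in> H" "0 \<le> s" "s \<le> \<sigma> k" "\<beta> k s \<in> rim (c l) \<tau>" for k l s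
  proof (cases "l = k")
    case True
    have "\<not> s < \<sigma> k" using \<sigma>(4)[OF that(1,3)] that(5) by (auto simp: rim_def True)
    then show ?thesis using that(4) True by simp
  next
    case False
    then show ?thesis using that off[of l k s] \<sigma>(2)[of k] by (auto simp: rim_def)
  qed
  have tip: "\<beta> k (\<sigma> k) \<in> rim (c k) \<tau>" if "k \<in> H" for k
    using \<sigma>(3)[OF that] by (simp add: rim_def)
  have J: "H = J \<union> prod.swap ` J" "J \<inter> prod.swap ` J = {}"
  proof -
    have "k \<in> J \<or> k \<in> prod.swap ` J" if "k \<in> H" for k
      using that by (cases "fst k < snd k") (auto simp: J_def H_def intro!: image_eqI[of _ _ "prod.swap k"])
    then show "H = J \<union> prod.swap ` J" using swapH by (auto simp: J_def)
  qed (auto simp: J_def)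
  have "2 * card J = n * (n - 1)"
  proof -
    have fin: "finite J" using finH by (simp add: J_def)
    have "card H = card J + card (prod.swap ` J)"
      by (subst J(1)) (rule card_Un_disjoint[OF fin finite_imageI[OF fin] J(2)])
    moreover have "card (prod.swap ` J) = card J" by (rule card_image) simp
    moreover have "card H = n * n - n"
    proof -
      have "H = {..<n} \<times> {..<n} - (\<lambda>i. (i, i)) ` {..<n}" by (auto simp: H_def image_iff)
      then have "card H = card ({..<n} \<times> {..<n}) - card ((\<lambda>i. (i, i)) ` {..<n})"
        by (metis (no_types, lifting) SigmaI card_Diff_subset finite_imageI finite_lessThan image_subsetI)
      moreover have "card ((\<lambda>i. (i, i)) ` {..<n}) = n" by (subst card_image) (auto simp: inj_on_def)
      ultimately show ?thesis by (simp add: card_cartesian_product)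
    qed
    ultimately show ?thesis by (simp add: diff_mult_distrib2)
  qed
  moreover have "sphere_with_handles (card J) X"
    by (rule sphere_with_handles_X[OF J, where R = R]) (auto simp: J_def N_def R)
  ultimately have genus: "has_euler_genus X (n * (n - 1))"
    unfolding has_euler_genus_def by metis
  define w where "w k s = q (\<beta> k s)" for k s
  \<comment> \<open>All half-edges at \<open>i\<close> start at the same point; the one towards 0,
    or towards 1 if \<open>i = 0\<close>, is an arbitrary choice.\<close>
  define p where "p i = w (i, if i = 0 then 1 else 0) 0" for i
  have "graph_embeddable {..<n} {e. e \<subseteq> {..<n} \<and> card e = 2} X"
  proof (rule complete_graph_embeddable[OF n, of \<sigma> X w p, folded H_def])
    fix k assume k: "k \<in> H"
    show "0 < \<sigma> k" using \<sigma> k by simp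
    show "w k 0 = p (fst k)"
      unfolding p_def w_def by (rule arg_cong[OF \<beta>_start]) simp
    show "w k (\<sigma> k) = w (prod.swap k) (\<sigma> (prod.swap k))"
      using q_M[OF k tip[OF k]] N(2)[OF k] by (simp add: w_def)
    have "continuous_map (top_of_set {0..\<sigma> k}) (top_of_set (punctured_sphere H c (\<lambda>_. \<tau>))) (\<beta> k)"
      using \<beta>P[OF k] cont_\<beta> by auto
    from continuous_map_compose[OF this cont_q]
    show "continuous_map (top_of_set {0..\<sigma> k}) X (w k)"
      by (simp only: w_def[abs_def] o_def)
    fix l s r
    assume l: "l \<in> H" and s: "0 \<le> s" "s \<le> \<sigma> k" and r: "0 \<le> r" "r \<le> \<sigma> l" and eq: "w k s = w l r"
    \<comment> \<open>Arcs that coincide on the sphere do so at a common vertex or at identical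
      positions. A proper gluing involves a rim, which an arc meets only at its own end, so it can
      only join two matching tips.\<close>
    then consider "\<beta> k s = \<beta> l r" | m where "m \<in> H" "\<beta> k s \<in> rim (c m) \<tau>" "\<beta> l r = N m *v \<beta> k s"
      using q_eq[OF \<beta>P[OF k s] \<beta>P[OF l r]] unfolding w_def by blast
    then show "k = l \<and> s = r \<or> s = 0 \<and> r = 0 \<and> fst k = fst l \<or> s = \<sigma> k \<and> r = \<sigma> l \<and> l = prod.swap k"
    proof cases
      case 1
      then show ?thesis using \<beta>_eq[OF k l 1] s \<sigma>(2)[OF k] by auto
    next
      case 2
      then have "m = k" "s = \<sigma> k" using on_rim[OF k _ s] by auto
      then have "\<beta> l r \<in> rim (c (prod.swap k)) \<tau>" using 2 N(2)[OF k] tip[OF swapH[OF k]] by simp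
      then show ?thesis using on_rim[OF l swapH[OF k] r] \<open>s = \<sigma> k\<close> by auto
    qed
  qed
  then show ?thesis using that surface_X genus by blast
qed

section \<open>Choice of the constant and of the genera\<close>

theorem mainTheorem10:
  shows "\<exists>c::real. c > 0 \<and>
    infinite {g::nat. g > 0 \<and>
      (\<exists>(V :: nat set) (E :: nat set set) (X :: (real^3) topology).
         simple_graph V E \<and> surface X \<and> has_euler_genus X g \<and> graph_embeddable V E X \<and>
         \<not> (\<exists>f. improper_coloring [0, 0, \<lfloor>c * sqrt (real g)\<rfloor>, \<lfloor>c * sqrt (real g)\<rfloor>] V E f))}"
proof (intro exI[of _ "1/4"] conjI)
  let ?G = "{g::nat. g > 0 \<and>
      (\<exists>(V :: nat set) (E :: nat set set) (X :: (real^3) topology).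
         simple_graph V E \<and> surface X \<and> has_euler_genus X g \<and> graph_embeddable V E X \<and>
         \<not> (\<exists>f. improper_coloring [0, 0, \<lfloor>1/4 * sqrt (real g)\<rfloor>, \<lfloor>1/4 * sqrt (real g)\<rfloor>] V E f))}"
  \<comment> \<open>With constant 1/4 and Euler genus below \<open>n^2\<close> the defect satisfies
    \<open>4 * d \<le> n\<close>, so \<open>2 * d + 4\<close> is at most \<open>n / 2 + 4\<close>,
    which is less than \<open>n\<close> exactly when \<open>n > 8\<close>.\<close>
  have in_G: "n * (n - 1) \<in> ?G" if n: "n \<ge> 9" for n
  proof -
    let ?E = "{e. e \<subseteq> {..<n} \<and> card e = 2}"
    define d where "d = \<lfloor>1/4 * sqrt (real (n * (n - 1)))\<rfloor>"
    have "n \<ge> 2" using n by simp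
    then obtain X :: "(real^3) topology" where X: "surface X" "has_euler_genus X (n * (n - 1))"
      "graph_embeddable {..<n} ?E X"
      by (rule complete_graph_surface_embedding)
    have "sqrt (real (n * (n - 1))) \<le> sqrt (real (n * n))"
      by (intro real_sqrt_le_mono of_nat_mono mult_le_mono) auto
    then have "sqrt (real (n * (n - 1))) \<le> real n" by simp
    then have "real_of_int d \<le> real n / 4"
      unfolding d_def by linarith
    then have d_le: "4 * d \<le> int n" by linarith
    have "d \<ge> 0" by (simp add: d_def)
    have "\<not> improper_coloring [0, 0, d, d] {..<n} ?E f" for f
    proof
      assume "improper_coloring [0, 0, d, d] {..<n} ?E f"
      then have "int (card {..<n}) \<le> (\<Sum>i<length [0, 0, d, d]. [0, 0, d, d] ! i + 1)"
        by (rule complete_graph_improper_coloring_bound) (use \<open>d \<ge> 0\<close> in auto)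
      also have "\<dots> = 2 * d + 4" by (simp add: lessThan_Suc numeral_eq_Suc)
      finally show False using d_le n by simp
    qed
    moreover have "simple_graph {..<n} ?E" by (auto simp: simple_graph_def)
    moreover have "n * (n - 1) > 0" using n by simp
    ultimately show ?thesis
      using X unfolding d_def mem_Collect_eq by (intro conjI exI[of _ "{..<n}"] exI[of _ ?E] exI[of _ X]) blast+
  qed
  have "inj_on (\<lambda>n::nat. n * (n - 1)) {9..}"
  proof (rule linorder_inj_onI')
    fix i j :: nat assume "i \<in> {9..}" "j \<in> {9..}" "i < j"
    then have "i * (i - 1) < j * (j - 1)" by (intro mult_strict_mono) auto
    then show "i * (i - 1) \<noteq> j * (j - 1)" by simp
  qed
  then have "infinite ((\<lambda>n::nat. n * (n - 1)) ` {9..})"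
    by (simp add: finite_image_iff infinite_Ici)
  moreover have "(\<lambda>n. n * (n - 1)) ` {9..} \<subseteq> ?G" using in_G by blast
  ultimately show "infinite ?G" using infinite_super by blast
qed simp

end
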